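(* Let $\mu>0$, let $L$ be the angular momentum, and let $$V(r)=\left(\frac{L^2}{r^2}+1\right)\left(1-\frac{\mu}{r^{2}}\right),\qquad r>0.$$ The equation $V'(r)=0$ for the extrema of $V$ is solved by $$r=\sqrt{\frac{\mu}{1-\frac{\mu}{L^2}}}$$ (only the positive root is of interest, since only $r>0$ is considered). For $L^2\geq\mu$ this value of $r$ is a local maximum of $V$. If $L^2<\mu$, no extrema of $V$ exist, and a particle with energy $E^2<1$ would move with increasing velocity onto the sphere $\{r^2=\mu\}$. In particular, local minima of $V$ do not exist for any values of $L$ and $\mu$, which means that no stable bounded orbits exist.
   Context: $V$ is the effective potential for timelike plane geodesic motion in the Tangherlini spacetime with $d=4$ space dimensions, i.e. for the metric $-\left(1-\frac{\mu}{r^{d-2}}\right)dt^2+\left(1-\frac{\mu}{r^{d-2}}\right)^{-1}dr^2+r^2g_{S^{d-1}}$ with $d=4$, where $g_{S^{d-1}}$ is the metric of the unit $(d-1)$-sphere and $\mu$ is the mass parameter. For general $d$ the potential is $V(r)=\left(\frac{L^2}{r^2}+1\right)\left(1-\frac{\mu}{r^{d-2}}\right)$. With the conserved quantities $E=\left(1-\frac{\mu}{r^{d-2}}\right)\dot t$ and $L=r^2\dot\chi_1$ ($\chi_1$ the angle in the plane of motion, dot the derivative with respect to proper time), the motion satisfies $E^2=\dot r^2+V(r)$. The hypersurface $\{r^{d-2}=\mu\}$ is called the Tangherlini sphere.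
   Formalization: The printed radius is not a zero of V'; it is corrected to r = sqrt(2μ/(1−μ/L²)). The local maximum is claimed for L² > μ; for L² = μ, where the radius is infinite, it is instead shown that V' has no zero, V → 1 and V ≤ 1 as r → ∞. *)

theory Defs
  imports "HOL-Analysis.Analysis"
begin

definition local_max_at :: "(real \<Rightarrow> real) \<Rightarrow> real \<Rightarrow> bool" where
  "local_max_at f x \<longleftrightarrow> (\<forall>\<^sub>F y in nhds x. f y \<le> f x)"

definition local_min_at :: "(real \<Rightarrow> real) \<Rightarrow> real \<Rightarrow> bool" where
  "local_min_at f x \<longleftrightarrow> (\<forall>\<^sub>F y in nhds x. f x \<le> f y)"

definition metric_factor :: "nat \<Rightarrow> real \<Rightarrow> real \<Rightarrow> real" where
  "metric_factor d \<mu> r = 1 - \<mu> / r ^ (d - 2)"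

definition eff_potential :: "nat \<Rightarrow> real \<Rightarrow> real \<Rightarrow> real \<Rightarrow> real" where
  "eff_potential d \<mu> L r = (L\<^sup>2 / r\<^sup>2 + 1) * metric_factor d \<mu> r"

text \<open>The Tangherlini metric restricted to a plane of motion through the centre, on which
  the metric of the unit sphere is the square of the differential of the angle
  \<open>\<phi>\<close>, evaluated on a tangent vector at radius \<open>r\<close>. The metric
  does not depend on \<open>t\<close> and \<open>\<phi>\<close>.\<close>

definition plane_lagrangian :: "nat \<Rightarrow> real \<Rightarrow> real \<Rightarrow> real \<Rightarrow> real \<Rightarrow> real \<Rightarrow> real" where
  "plane_lagrangian d \<mu> r vt vr vc =
     - metric_factor d \<mu> r * vt\<^sup>2 + inverse (metric_factor d \<mu> r) * vr\<^sup>2 + r\<^sup>2 * vc\<^sup>2"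

text \<open>Derivative with respect to proper time of a coordinate of a worldline parametrised by the
  interval \<open>I\<close>; one-sided at end points belonging to \<open>I\<close>.\<close>

definition ptd :: "real set \<Rightarrow> (real \<Rightarrow> real) \<Rightarrow> real \<Rightarrow> real" where
  "ptd I x \<tau> = vector_derivative x (at \<tau> within I)"

text \<open>A timelike geodesic lying in a plane and outside the Tangherlini sphere, parametrised by
  proper time: the Euler-Lagrange equations of the Lagrangian above, for the coordinates
  \<open>t\<close>, \<open>\<phi>\<close> and \<open>r\<close> in this order, together with the
  normalisation of the tangent vector. The radial equation is not redundant: a constant radius at
  a turning point satisfies all the others.\<close>

definition plane_geodesic ::
  "nat \<Rightarrow> real \<Rightarrow> real set \<Rightarrow> (real \<Rightarrow> real) \<Rightarrow> (real \<Rightarrow> real) \<Rightarrow> (real \<Rightarrow> real) \<Rightarrow> bool" where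
  "plane_geodesic d \<mu> I t r \<phi> \<longleftrightarrow>
     is_interval I \<and> interior I \<noteq> {} \<and>
     (\<forall>\<tau>\<in>I.
        r \<tau> > 0 \<and> r \<tau> ^ (d - 2) > \<mu> \<and>
        t differentiable (at \<tau> within I) \<and>
        r differentiable (at \<tau> within I) \<and>
        \<phi> differentiable (at \<tau> within I) \<and>
        plane_lagrangian d \<mu> (r \<tau>) (ptd I t \<tau>) (ptd I r \<tau>) (ptd I \<phi> \<tau>) = -1 \<and>
        ((\<lambda>s. deriv (\<lambda>v. plane_lagrangian d \<mu> (r s) v (ptd I r s) (ptd I \<phi> s)) (ptd I t s))
           has_real_derivative 0) (at \<tau> within I) \<and>
        ((\<lambda>s. deriv (\<lambda>v. plane_lagrangian d \<mu> (r s) (ptd I t s) (ptd I r s) v) (ptd I \<phi> s))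
           has_real_derivative 0) (at \<tau> within I) \<and>
        ((\<lambda>s. deriv (\<lambda>v. plane_lagrangian d \<mu> (r s) (ptd I t s) v (ptd I \<phi> s)) (ptd I r s))
           has_real_derivative
           deriv (\<lambda>q. plane_lagrangian d \<mu> q (ptd I t \<tau>) (ptd I r \<tau>) (ptd I \<phi> \<tau>)) (r \<tau>))
          (at \<tau> within I))"

definition energy ::
  "nat \<Rightarrow> real \<Rightarrow> real set \<Rightarrow> (real \<Rightarrow> real) \<Rightarrow> (real \<Rightarrow> real) \<Rightarrow> real \<Rightarrow> real" where
  "energy d \<mu> I t r \<tau> = metric_factor d \<mu> (r \<tau>) * ptd I t \<tau>"

definition angular_momentum ::
  "real set \<Rightarrow> (real \<Rightarrow> real) \<Rightarrow> (real \<Rightarrow> real) \<Rightarrow> real \<Rightarrow> real" where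
  "angular_momentum I r \<phi> \<tau> = (r \<tau>)\<^sup>2 * ptd I \<phi> \<tau>"

definition geodesic_with ::
  "nat \<Rightarrow> real \<Rightarrow> real \<Rightarrow> real \<Rightarrow> real set \<Rightarrow> (real \<Rightarrow> real) \<Rightarrow> (real \<Rightarrow> real) \<Rightarrow> (real \<Rightarrow> real) \<Rightarrow> bool"
  where
  "geodesic_with d \<mu> E L I t r \<phi> \<longleftrightarrow>
     plane_geodesic d \<mu> I t r \<phi> \<and>
     (\<forall>\<tau>\<in>I. energy d \<mu> I t r \<tau> = E \<and> angular_momentum I r \<phi> \<tau> = L)"

text \<open>The particle starts at proper time 0 and its worldline cannot be continued any further to
  the future as a geodesic outside the Tangherlini sphere.\<close>

definition future_inextendible ::
  "nat \<Rightarrow> real \<Rightarrow> real set \<Rightarrow> (real \<Rightarrow> real) \<Rightarrow> (real \<Rightarrow> real) \<Rightarrow> (real \<Rightarrow> real) \<Rightarrow> bool" where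
  "future_inextendible d \<mu> I t r \<phi> \<longleftrightarrow>
     0 \<in> I \<and> I \<subseteq> {0..} \<and>
     (\<forall>J t' r' \<phi>'.
        plane_geodesic d \<mu> J t' r' \<phi>' \<and> I \<subseteq> J \<and> J \<subseteq> {0..} \<and>
        (\<forall>\<tau>\<in>I. t' \<tau> = t \<tau> \<and> r' \<tau> = r \<tau> \<and> \<phi>' \<tau> = \<phi> \<tau>) \<longrightarrow> J = I)"

text \<open>An orbit is bounded if it stays outside the Tangherlini sphere and in a bounded region for
  all future proper time. Stability is Lyapunov stability of the radius, tested only against
  perturbations of the initial radius and radial velocity at fixed angular momentum; admitting more
  perturbations, or also controlling the velocity, would make fewer orbits stable.\<close>

definition bounded_orbit ::
  "nat \<Rightarrow> real \<Rightarrow> real \<Rightarrow> real \<Rightarrow> (real \<Rightarrow> real) \<Rightarrow> (real \<Rightarrow> real) \<Rightarrow> (real \<Rightarrow> real) \<Rightarrow> bool" where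
  "bounded_orbit d \<mu> E L t r \<phi> \<longleftrightarrow>
     geodesic_with d \<mu> E L {0..} t r \<phi> \<and> bounded (r ` {0..})"

definition stable_orbit ::
  "nat \<Rightarrow> real \<Rightarrow> real \<Rightarrow> (real \<Rightarrow> real) \<Rightarrow> bool" where
  "stable_orbit d \<mu> L r \<longleftrightarrow>
     (\<forall>\<epsilon>>0. \<exists>\<delta>>0. \<forall>T>0. \<forall>E' t' r' \<phi>'.
        geodesic_with d \<mu> E' L {0..<T} t' r' \<phi>' \<and>
        \<bar>r' 0 - r 0\<bar> < \<delta> \<and> \<bar>ptd {0..<T} r' 0 - ptd {0..} r 0\<bar> < \<delta> \<longrightarrow>
        (\<forall>\<tau>\<in>{0..<T}. \<bar>r' \<tau> - r \<tau>\<bar> < \<epsilon>))"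

lemma energy_equation:
  assumes "geodesic_with d \<mu> E L I t r \<phi>" and "\<tau> \<in> I"
  shows "E\<^sup>2 = (ptd I r \<tau>)\<^sup>2 + eff_potential d \<mu> L (r \<tau>)"
proof -
  let ?f = "metric_factor d \<mu> (r \<tau>)"
  from assms have r: "r \<tau> > 0" "r \<tau> ^ (d - 2) > \<mu>"
    and n: "plane_lagrangian d \<mu> (r \<tau>) (ptd I t \<tau>) (ptd I r \<tau>) (ptd I \<phi> \<tau>) = -1"
    and E: "E = ?f * ptd I t \<tau>" and L: "L = (r \<tau>)\<^sup>2 * ptd I \<phi> \<tau>"
    by (auto simp: geodesic_with_def plane_geodesic_def energy_def angular_momentum_def)
  have f: "?f \<noteq> 0" using r by (auto simp: metric_factor_def field_simps)
  have L2: "L\<^sup>2 / (r \<tau>)\<^sup>2 = (r \<tau>)\<^sup>2 * (ptd I \<phi> \<tau>)\<^sup>2"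
    using r by (simp add: L power2_eq_square)
  have "?f * plane_lagrangian d \<mu> (r \<tau>) (ptd I t \<tau>) (ptd I r \<tau>) (ptd I \<phi> \<tau>) =
     - E\<^sup>2 + (ptd I r \<tau>)\<^sup>2 + ?f * (L\<^sup>2 / (r \<tau>)\<^sup>2)"
    unfolding L2 plane_lagrangian_def E using f by (simp add: algebra_simps power2_eq_square)
  with n show ?thesis by (simp add: eff_potential_def algebra_simps)
qed

lemma eff_potential_4_has_derivative:
  assumes "r \<noteq> 0"
  shows "(eff_potential 4 \<mu> L has_real_derivative
           - 2 * ((L\<^sup>2 - \<mu>) * r\<^sup>2 - 2 * L\<^sup>2 * \<mu>) / r ^ 5) (at r)"
  unfolding eff_potential_def[abs_def] metric_factor_def
  using assms
  by (auto intro!: derivative_eq_intros simp: field_simps power2_eq_square eval_nat_numeral)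

text \<open>Hence the positive critical point is \<open>sqrt (2 * \<mu> / (1 - \<mu> / L\<^sup>2))\<close>. The
  same formula without the factor 2, which is found in the literature, is not a critical point.\<close>

lemma not_critical_without_factor_2:
  assumes "\<mu> > 0" and "L\<^sup>2 > \<mu>"
  shows "deriv (eff_potential 4 \<mu> L) (sqrt (\<mu> / (1 - \<mu> / L\<^sup>2))) \<noteq> 0"
proof -
  let ?r = "sqrt (\<mu> / (1 - \<mu> / L\<^sup>2))"
  have L0: "L \<noteq> 0" using assms by auto
  have pos: "\<mu> / (1 - \<mu> / L\<^sup>2) > 0" using assms L0 by (simp add: field_simps)
  then have r: "?r > 0" by simp
  have "(L\<^sup>2 - \<mu>) * ?r\<^sup>2 = L\<^sup>2 * \<mu>" using assms L0 pos by (simp add: field_simps)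
  then have "(L\<^sup>2 - \<mu>) * ?r\<^sup>2 - 2 * L\<^sup>2 * \<mu> \<noteq> 0" using assms L0 by simp
  then have "- 2 * ((L\<^sup>2 - \<mu>) * ?r\<^sup>2 - 2 * L\<^sup>2 * \<mu>) / ?r ^ 5 \<noteq> 0"
    using r by (metis divide_eq_0_iff less_irrefl mult_eq_0_iff neg_equal_0_iff_equal
      power_not_zero zero_neq_numeral)
  moreover have "deriv (eff_potential 4 \<mu> L) ?r =
      - 2 * ((L\<^sup>2 - \<mu>) * ?r\<^sup>2 - 2 * L\<^sup>2 * \<mu>) / ?r ^ 5"
    by (intro DERIV_imp_deriv eff_potential_4_has_derivative less_imp_neq[OF r, symmetric])
  ultimately show ?thesis by metis
qed

end

theory Submission
  imports Defs
begin

text \<open>In dimension four \<open>V r = V r\<^sub>0 - L\<^sup>2 * \<mu> * (1 / r\<^sup>2 - 1 / r\<^sub>0\<^sup>2)\<^sup>2\<close> whenever a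
  critical radius \<open>r\<^sub>0\<close> exists, so that it is a global maximum. Geodesics amount to solutions of
  \<open>r'' = - V' r / 2\<close> with \<open>r'\<^sup>2 + V r = E\<^sup>2\<close>; as \<open>\<bar>r'\<bar> \<le> \<bar>E\<bar>\<close> outside the sphere, a
  motion confined to a compact set of radii without a critical point lasts only a finite time.

  For \<open>L\<^sup>2 < \<mu>\<close> and \<open>E\<^sup>2 < 1\<close> the motion is confined and ends at a finite time, and it
  can be continued unless the limiting radius is \<open>sqrt \<mu>\<close>. Instead of an existence theorem for
  second-order equations, the continuation uses a time reflection at a turning point and separation
  of variables in \<open>r' = \<plusminus> sqrt (E\<^sup>2 - V r)\<close> elsewhere.

  A bounded orbit has \<open>E\<^sup>2 \<ge> V r\<^sub>0\<close>. With slightly more energy the particle has no turning point, so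
  it either escapes to infinity or falls through \<open>r\<^sub>0\<close>, while the orbit itself remains bounded
  or, if it starts inwards, outside \<open>r\<^sub>0\<close>.\<close>

section \<open>Calculus on real intervals\<close>

text \<open>An interval with interior points is connected and not a singleton, so each of its points
  is a limit point. This makes one-sided derivatives unique, so that \<open>ptd\<close> is
  determined by any derivative.\<close>

lemma at_within_interval_nontrivial:
  fixes I :: "real set"
  assumes "is_interval I" "interior I \<noteq> {}" "x \<in> I"
  shows "at x within I \<noteq> bot"
proof -
  have "I \<noteq> {y}" for y
    using assms(2) by auto
  then show ?thesis
    using connected_imp_perfect[of I x] assms(1,3)
    by (simp add: is_interval_connected_1 trivial_limit_within)
qed

text \<open>The usual mean value theorem applies because at inner points of \<open>{a..b}\<close>
  the derivative within \<open>I\<close> is the ordinary one.\<close>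

lemma mvt_within_interval:
  fixes f :: "real \<Rightarrow> real"
  assumes I: "is_interval I" "a \<in> I" "b \<in> I" and "a < b"
    and f: "\<And>x. x \<in> I \<Longrightarrow> (f has_real_derivative f' x) (at x within I)"
  obtains z where "a < z" "z < b" "z \<in> I" "f b - f a = (b - a) * f' z"
proof -
  have sub: "{a..b} \<subseteq> I"
    using mem_is_interval_1_I[OF I] by auto
  have ab: "(f has_real_derivative f' x) (at x within {a..b})" if "x \<in> {a..b}" for x
    using f[of x] sub that by (meson DERIV_subset subsetD)
  have "(f has_derivative (*) (f' x)) (at x)" if "a < x" "x < b" for x
    using ab[of x] that by (simp add: at_within_Icc_at has_field_derivative_def)
  moreover have "continuous_on {a..b} f"
    using ab by (meson DERIV_continuous_on)
  ultimately obtain z where "a < z" "z < b" "f b - f a = f' z * (b - a)"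
    using mvt[OF \<open>a < b\<close>, of f "\<lambda>x. (*) (f' x)"] by blast
  with that[of z] subsetD[OF sub, of z] show ?thesis by (simp add: mult.commute)
qed

lemma has_field_derivative_eq_on:
  assumes "(f has_field_derivative D) (at x within S)" "x \<in> S" "\<And>y. y \<in> S \<Longrightarrow> f y = g y"
  shows "(g has_field_derivative D) (at x within S)"
  using has_field_derivative_transform_within[OF assms(1) zero_less_one assms(2)] assms(3) by blast

text \<open>Off a closed set the filter within it is trivial, so both derivative claims hold at
  every point of the union; limits within two sets then give the limit within their union.\<close>

lemma has_field_derivative_paste:
  assumes "closed S" "closed T" "x \<in> S \<union> T"
    and "x \<in> S \<Longrightarrow> (f has_field_derivative D) (at x within S)"
    and "x \<in> T \<Longrightarrow> (f has_field_derivative D) (at x within T)"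
  shows "(f has_field_derivative D) (at x within (S \<union> T))"
proof -
  have bot: "at x within A = bot" if "closed A" "x \<notin> A" for A
    using that by (metis closed_limpt trivial_limit_within)
  have "(f has_field_derivative D) (at x within S)" "(f has_field_derivative D) (at x within T)"
    using assms(3-5) bot[OF assms(1)] bot[OF assms(2)]
    by (cases "x \<in> S"; cases "x \<in> T"; auto simp: has_field_derivative_iff)+
  then show ?thesis
    unfolding has_field_derivative_iff by (rule Lim_Un)
qed

lemma real_antiderivative_on_interval:
  fixes f :: "real \<Rightarrow> real"
  assumes "continuous_on {a..b} f"
  obtains F where "F a = c"
    "\<And>x. x \<in> {a..b} \<Longrightarrow> (F has_real_derivative f x) (at x within {a..b})"
proof -
  obtain G where G: "\<And>x. x \<in> {a..b} \<Longrightarrow> (G has_vector_derivative f x) (at x within {a..b})"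
    using antiderivative_continuous[OF assms] by blast
  show ?thesis
  proof (rule that[of "\<lambda>x. G x - G a + c"])
    fix x assume "x \<in> {a..b}"
    then show "((\<lambda>x. G x - G a + c) has_real_derivative f x) (at x within {a..b})"
      using G[of x]
      by (auto simp: has_real_derivative_iff_has_vector_derivative[symmetric]
          intro!: derivative_eq_intros)
  qed simp
qed

section \<open>Extension to the right end point of an interval\<close>

text \<open>A bounded derivative makes \<open>f\<close> Lipschitz, hence uniformly continuous, and
  so extendable to the closure. This is applied to the radius, whose speed is at most
  \<open>\<bar>E\<bar>\<close>.\<close>

lemma bounded_derivative_extends_continuously:
  fixes f :: "real \<Rightarrow> real"
  assumes "a < b" and f: "\<And>x. x \<in> {a..<b} \<Longrightarrow> (f has_real_derivative f' x) (at x within {a..<b})"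
    and B: "\<And>x. x \<in> {a..<b} \<Longrightarrow> \<bar>f' x\<bar> \<le> B"
  obtains g where "continuous_on {a..b} g" "\<And>x. x \<in> {a..<b} \<Longrightarrow> g x = f x"
proof -
  have "B \<ge> 0" using B[of a] \<open>a < b\<close> by simp
  have "B-lipschitz_on {a..<b} f"
  proof (rule lipschitz_onI)
    fix x y assume "x \<in> {a..<b}" "y \<in> {a..<b}"
    then show "dist (f x) (f y) \<le> B * dist x y"
      using field_differentiable_bound[of "{a..<b}" f f' B x y] f B
      by (simp add: dist_norm)
  qed fact
  then have "uniformly_continuous_on {a..<b} f"
    by (rule lipschitz_on_uniformly_continuous)
  then obtain g where "uniformly_continuous_on (closure {a..<b}) g" "\<And>x. x \<in> {a..<b} \<Longrightarrow> f x = g x"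
    by (rule uniformly_continuous_on_extension_on_closure) blast
  then show ?thesis
    using that[of g] \<open>a < b\<close> uniformly_continuous_imp_continuous[of "{a..b}" g] by simp
qed

lemma eq_at_right_end_if_eq_before:
  fixes f g :: "real \<Rightarrow> real"
  assumes "a < b" "continuous_on {a..b} f" "continuous_on {a..b} g"
    and "\<And>x. x \<in> {a..<b} \<Longrightarrow> f x = g x" and "x \<in> {a..b}"
  shows "f x = g x"
proof -
  have "closed {x \<in> {a..b}. f x = g x}"
    using continuous_closed_preimage_constant[OF continuous_on_diff[OF assms(2,3)], where a = 0]
    by simp
  moreover have "{a..<b} \<subseteq> {x \<in> {a..b}. f x = g x}"
    using assms(4) by auto
  ultimately have "closure {a..<b} \<subseteq> {x \<in> {a..b}. f x = g x}"
    by (intro closure_minimal)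
  with assms(1,5) show ?thesis by auto
qed

text \<open>The primitive of \<open>h\<close> with value \<open>f a\<close> at \<open>a\<close>
  differs from \<open>f\<close> by a constant before \<open>b\<close>, and this constant is zero.
  Unlike a merely continuous extension it has a derivative at \<open>b\<close>.\<close>

lemma primitive_extends_to_right_end:
  fixes f :: "real \<Rightarrow> real"
  assumes "a < b" and f: "\<And>x. x \<in> {a..<b} \<Longrightarrow> (f has_real_derivative h x) (at x within {a..<b})"
    and h: "continuous_on {a..b} h"
  obtains F where "\<And>x. x \<in> {a..<b} \<Longrightarrow> F x = f x"
    "\<And>x. x \<in> {a..b} \<Longrightarrow> (F has_real_derivative h x) (at x within {a..b})"
proof -
  obtain F where F: "F a = f a" "\<And>x. x \<in> {a..b} \<Longrightarrow> (F has_real_derivative h x) (at x within {a..b})"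
    using real_antiderivative_on_interval[OF h] by blast
  have "((\<lambda>x. F x - f x) has_real_derivative 0) (at x within {a..<b})" if "x \<in> {a..<b}" for x
  proof -
    have "(F has_real_derivative h x) (at x within {a..<b})"
      by (rule DERIV_subset[OF F(2)]) (use that in auto)
    from DERIV_diff[OF this f[OF that]] show ?thesis by simp
  qed
  then obtain c where "\<And>x. x \<in> {a..<b} \<Longrightarrow> F x - f x = c"
    using has_field_derivative_zero_constant[of "{a..<b}" "\<lambda>x. F x - f x"] by auto
  note c = this
  have "c = 0" using c[of a] F(1) \<open>a < b\<close> by simp
  with c have "F x = f x" if "x \<in> {a..<b}" for x
    using that by fastforce
  with F(2) that show ?thesis by blast
qed

text \<open>Supplies first and last times of a sign condition, and the compactness of the set of
  radii allowed by the energy.\<close>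

lemma compact_le_set:
  fixes f g :: "real \<Rightarrow> real"
  assumes "continuous_on {a..b} f" "continuous_on {a..b} g"
  shows "compact {x \<in> {a..b}. f x \<le> g x}"
proof -
  have "closed {x \<in> {a..b}. f x \<le> g x}"
    using assms by (intro continuous_on_closed_Collect_le) auto
  moreover have "bounded {x \<in> {a..b}. f x \<le> g x}"
    by (rule bounded_subset[OF bounded_closed_interval[of a b]]) auto
  ultimately show ?thesis by (simp add: compact_eq_bounded_closed)
qed

text \<open>Separation of variables: the solution is the inverse of a primitive of \<open>1 / g\<close>.\<close>

lemma autonomous_ode_solution:
  fixes g :: "real \<Rightarrow> real"
  assumes "a < b" "continuous_on {a..b} g" "\<And>x. x \<in> {a..b} \<Longrightarrow> g x > 0"
  obtains T y where "T0 < T" "y T0 = a" "y T = b" "\<And>\<tau>. \<tau> \<in> {T0..T} \<Longrightarrow> y \<tau> \<in> {a..b}"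
    "\<And>\<tau>. \<tau> \<in> {T0..T} \<Longrightarrow> (y has_real_derivative g (y \<tau>)) (at \<tau> within {T0..T})"
proof -
  \<comment> \<open>Clamping to \<open>{a..b}\<close> extends \<open>1 / g\<close> continuously and
    positively beyond both ends, so that its primitive has two-sided derivatives at \<open>a\<close>
    and \<open>b\<close>.\<close>
  define c where "c x = max a (min b x)" for x
  have c: "c x \<in> {a..b}" for x using \<open>a < b\<close> by (auto simp: c_def)
  have "continuous_on {a-1..b+1} (\<lambda>x. 1 / g (c x))"
    using less_imp_neq[OF assms(3)[OF c]] c
    by (intro continuous_intros continuous_on_compose2[OF assms(2)])
       (auto simp: c_def intro!: continuous_intros)
  then obtain P where P: "\<And>x. x \<in> {a-1..b+1} \<Longrightarrow>
      (P has_real_derivative 1 / g (c x)) (at x within {a-1..b+1})"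
    using real_antiderivative_on_interval by metis
  \<comment> \<open>On \<open>{a..b}\<close>, \<open>Q x\<close> is the time at which the solution
    reaches \<open>x\<close>, normalised by \<open>Q a = T0\<close>.\<close>
  define Q where "Q x = P x - P a + T0" for x
  have Q: "(Q has_real_derivative 1 / g (c x)) (at x)" if "a-1 < x" "x < b+1" for x
    using P[of x] that at_within_Icc_at[OF that]
    unfolding Q_def by (auto intro!: derivative_eq_intros)
  have mono: "Q x < Q y" if "a-1 < x" "x < y" "y < b+1" for x y
  proof (rule DERIV_pos_imp_increasing[OF \<open>x < y\<close>])
    fix z assume "x \<le> z" "z \<le> y"
    then show "\<exists>d. (Q has_real_derivative d) (at z) \<and> d > 0"
      using Q[of z] that assms(3)[OF c] by (intro exI[of _ "1 / g (c z)"]) auto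
  qed
  \<comment> \<open>Half of the unit margin keeps \<open>a\<close> and \<open>b\<close> in the
    interior of \<open>{A..B}\<close>, so that the inverse function rule applies at their times
    too.\<close>
  define A B where "A = a - 1/2" and "B = b + 1/2"
  have AB: "a - 1 < A" "A < a" "b < B" "B < b + 1" by (auto simp: A_def B_def)
  have cont: "continuous_on {A..B} Q"
    using Q AB by (meson DERIV_isCont atLeastAtMost_iff continuous_at_imp_continuous_on less_le_trans le_less_trans)
  have inj: "inj_on Q {A..B}"
    using mono AB by (intro linorder_inj_onI) (fastforce simp: less_le)+
  define y where "y = the_inv_into {A..B} Q"
  have yQ: "y (Q x) = x" if "x \<in> {A..B}" for x
    unfolding y_def using inj that by (rule the_inv_into_f_f)
  have surj: "\<exists>x\<in>{A..B}. Q x = \<tau>" if "\<tau> \<in> {Q A..Q B}" for \<tau>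
    using IVT'[of Q A \<tau> B] that cont AB \<open>a < b\<close> by force
  have conty: "continuous_on (Q ` {A..B}) y"
    unfolding y_def using cont inj by (intro continuous_on_inv_into) auto
  have img: "Q ` {A..B} = {Q A..Q B}"
  proof
    show "Q ` {A..B} \<subseteq> {Q A..Q B}"
      using mono AB by (auto simp: le_less)
  qed (use surj in blast)
  have dy: "(y has_real_derivative g (y \<tau>)) (at \<tau>)" "y \<tau> \<in> {a..b}" if \<tau>: "\<tau> \<in> {Q a..Q b}" for \<tau>
  proof -
    have ends: "Q A < \<tau>" "\<tau> < Q B"
      using \<tau> mono[of A a] mono[of b B] AB \<open>a < b\<close> by auto
    obtain x where x: "x \<in> {a..b}" "Q x = \<tau>"
      using IVT'[of Q a \<tau> b] \<tau> continuous_on_subset[OF cont, of "{a..b}"] AB \<open>a < b\<close> by force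
    then have yx: "y \<tau> = x" using yQ AB by auto
    then show "y \<tau> \<in> {a..b}" using x by simp
    have cx: "c x = x" using x by (auto simp: c_def)
    have "isCont y \<tau>"
      using conty ends unfolding img by (intro continuous_on_interior[of "{Q A..Q B}"]) auto
    moreover have "(Q has_real_derivative 1 / g x) (at (y \<tau>))"
      using Q[of x] x yx cx AB by auto
    moreover have "Q (y z) = z" if "Q A < z" "z < Q B" for z
      using surj[of z] that yQ by force
    ultimately have "(y has_real_derivative inverse (1 / g x)) (at \<tau>)"
      using ends assms(3)[OF x(1)] by (intro DERIV_inverse_function[where f = Q and a = "Q A" and b = "Q B"]) auto
    then show "(y has_real_derivative g (y \<tau>)) (at \<tau>)" by (simp add: yx)
  qed
  show ?thesis
  proof (rule that[of "Q b" y])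
    show "T0 < Q b" using mono[of a b] \<open>a < b\<close> by (simp add: Q_def)
    show "y T0 = a" using yQ[of a] AB \<open>a < b\<close> by (simp add: Q_def)
    show "y (Q b) = b" using yQ[of b] AB \<open>a < b\<close> by simp
    have "Q a = T0" by (simp add: Q_def)
    with dy show "\<And>\<tau>. \<tau> \<in> {T0..Q b} \<Longrightarrow> y \<tau> \<in> {a..b}"
      "\<And>\<tau>. \<tau> \<in> {T0..Q b} \<Longrightarrow> (y has_real_derivative g (y \<tau>)) (at \<tau> within {T0..Q b})"
      by (auto intro: has_field_derivative_at_within)
  qed
qed

section \<open>Reduction to the radial motion\<close>

lemma metric_factor_4_has_derivative:
  assumes "r \<noteq> 0"
  shows "(metric_factor 4 \<mu> has_real_derivative 2 * \<mu> / r ^ 3) (at r)"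
  unfolding metric_factor_def[abs_def] using assms
  by (auto intro!: derivative_eq_intros simp: field_simps eval_nat_numeral)

lemma metric_factor_4_pos:
  assumes "\<mu> > 0" "r > sqrt \<mu>"
  shows "metric_factor 4 \<mu> r > 0"
proof -
  have "r > 0" using assms real_sqrt_gt_zero less_trans by blast
  moreover have "\<mu> < r\<^sup>2"
    using assms power_strict_mono[of "sqrt \<mu>" r 2] by simp
  ultimately show ?thesis by (simp add: metric_factor_def)
qed

text \<open>This is \<open>- V' r / 2\<close>: differentiating
  \<open>r'\<^sup>2 + V r = E\<^sup>2\<close> gives
  \<open>2 * r' * r'' = - V' r * r'\<close>.\<close>

definition radial_force :: "real \<Rightarrow> real \<Rightarrow> real \<Rightarrow> real" where
  "radial_force \<mu> L r = ((L\<^sup>2 - \<mu>) * r\<^sup>2 - 2 * L\<^sup>2 * \<mu>) / r ^ 5"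

text \<open>A separate velocity \<open>w\<close> keeps restriction, pasting and reflection free of
  \<open>ptd\<close>, which refers to the interval. The force law stands next to the energy equation
  because a constant radius at a turning point satisfies the latter as well; conversely the force
  law leaves the value of the energy open.\<close>

definition radial_motion :: "real \<Rightarrow> real \<Rightarrow> real \<Rightarrow> real set \<Rightarrow>
    (real \<Rightarrow> real) \<Rightarrow> (real \<Rightarrow> real) \<Rightarrow> (real \<Rightarrow> real) \<Rightarrow> (real \<Rightarrow> real) \<Rightarrow> bool" where
  "radial_motion \<mu> E L I t r \<phi> w \<longleftrightarrow> (\<forall>\<tau>\<in>I.
     r \<tau> > sqrt \<mu> \<and>
     (t has_real_derivative E / metric_factor 4 \<mu> (r \<tau>)) (at \<tau> within I) \<and>
     (\<phi> has_real_derivative L / (r \<tau>)\<^sup>2) (at \<tau> within I) \<and>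
     (r has_real_derivative w \<tau>) (at \<tau> within I) \<and>
     (w has_real_derivative radial_force \<mu> L (r \<tau>)) (at \<tau> within I) \<and>
     (w \<tau>)\<^sup>2 + eff_potential 4 \<mu> L (r \<tau>) = E\<^sup>2)"

lemma deriv_plane_lagrangian_t:
  "deriv (\<lambda>v. plane_lagrangian d \<mu> q v vr vc) vt = - 2 * metric_factor d \<mu> q * vt"
  unfolding plane_lagrangian_def
  by (rule DERIV_imp_deriv) (auto intro!: derivative_eq_intros)

lemma deriv_plane_lagrangian_phi:
  "deriv (\<lambda>v. plane_lagrangian d \<mu> q vt vr v) vc = 2 * q\<^sup>2 * vc"
  unfolding plane_lagrangian_def
  by (rule DERIV_imp_deriv) (auto intro!: derivative_eq_intros)

lemma deriv_plane_lagrangian_r: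
  "deriv (\<lambda>v. plane_lagrangian d \<mu> q vt v vc) vr = 2 * inverse (metric_factor d \<mu> q) * vr"
  unfolding plane_lagrangian_def
  by (rule DERIV_imp_deriv) (auto intro!: derivative_eq_intros)

lemma deriv_plane_lagrangian_radius:
  assumes "q \<noteq> 0" "metric_factor 4 \<mu> q \<noteq> 0"
  shows "deriv (\<lambda>q. plane_lagrangian 4 \<mu> q vt vr vc) q =
    - (2 * \<mu> / q ^ 3) * vt\<^sup>2 - (2 * \<mu> / q ^ 3) / (metric_factor 4 \<mu> q)\<^sup>2 * vr\<^sup>2 + 2 * q * vc\<^sup>2"
  unfolding plane_lagrangian_def
  by (rule DERIV_imp_deriv)
     (use assms in \<open>auto intro!: derivative_eq_intros metric_factor_4_has_derivative
       simp: power2_eq_square divide_inverse\<close>)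

text \<open>The radial Euler-Lagrange equation, solved for the acceleration with the help of the
  energy equation \<open>w\<^sup>2 = E\<^sup>2 - V r\<close>.\<close>

lemma radial_force_alt:
  assumes "r > 0" "f = metric_factor 4 \<mu> r" "f \<noteq> 0" "w\<^sup>2 + eff_potential 4 \<mu> L r = E\<^sup>2"
  shows "(2 * \<mu> / r ^ 3) * w\<^sup>2 / f + f / 2 * (- (2 * \<mu> / r ^ 3) * (E / f)\<^sup>2
      - (2 * \<mu> / r ^ 3) / f\<^sup>2 * w\<^sup>2 + 2 * r * (L / r\<^sup>2)\<^sup>2) = radial_force \<mu> L r"
proof -
  have E: "E\<^sup>2 = w\<^sup>2 + (L\<^sup>2 / r\<^sup>2 + 1) * f"
    using assms by (simp add: eff_potential_def)
  have "(2 * \<mu> / r ^ 3) * w\<^sup>2 / f + f / 2 * (- (2 * \<mu> / r ^ 3) * (E / f)\<^sup>2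
      - (2 * \<mu> / r ^ 3) / f\<^sup>2 * w\<^sup>2 + 2 * r * (L / r\<^sup>2)\<^sup>2) =
      (\<mu> / r ^ 3) * (w\<^sup>2 - E\<^sup>2) / f + f * L\<^sup>2 / r ^ 3"
    using assms(1,3) by (simp add: field_simps power2_eq_square eval_nat_numeral)
  also have "\<dots> = - (\<mu> / r ^ 3) * (L\<^sup>2 / r\<^sup>2 + 1) + f * L\<^sup>2 / r ^ 3"
    using assms(3) by (simp add: E)
  also have "\<dots> = radial_force \<mu> L r"
    using assms(1) unfolding assms(2) radial_force_def metric_factor_def
    by (simp add: field_simps power2_eq_square eval_nat_numeral)
  finally show ?thesis .
qed

lemma ptd_eq:
  assumes "is_interval I" "interior I \<noteq> {}" "\<tau> \<in> I" "(x has_real_derivative v) (at \<tau> within I)"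
  shows "ptd I x \<tau> = v"
  unfolding ptd_def using assms at_within_interval_nontrivial
  by (simp add: has_real_derivative_iff_has_vector_derivative vector_derivative_within)

lemma ptd_has_derivative:
  assumes "x differentiable (at \<tau> within I)"
  shows "(x has_real_derivative ptd I x \<tau>) (at \<tau> within I)"
  using assms
  unfolding ptd_def has_real_derivative_iff_has_vector_derivative vector_derivative_works .

text \<open>Differentiability of the radial velocity \<open>w\<close> has to be derived: the
  Euler-Lagrange equation says that \<open>2 * w / f\<close> is differentiable, with
  \<open>f\<close> the metric factor along the orbit, and the product rule with \<open>f / 2\<close>
  recovers \<open>w\<close>.\<close>

lemma radial_motion_if_geodesic:
  assumes "\<mu> > 0" "geodesic_with 4 \<mu> E L I t r \<phi>"
  shows "radial_motion \<mu> E L I t r \<phi> (ptd I r)"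
  unfolding radial_motion_def
proof (rule ballI)
  fix \<tau> assume \<tau>: "\<tau> \<in> I"
  let ?w = "ptd I r" and ?f = "\<lambda>s. metric_factor 4 \<mu> (r s)"
  have geo: "r \<tau> > 0" "(r \<tau>)\<^sup>2 > \<mu>"
    "t differentiable (at \<tau> within I)" "r differentiable (at \<tau> within I)"
    "\<phi> differentiable (at \<tau> within I)"
    and EL: "((\<lambda>s. deriv (\<lambda>v. plane_lagrangian 4 \<mu> (r s) (ptd I t s) v (ptd I \<phi> s)) (ptd I r s))
           has_real_derivative
           deriv (\<lambda>q. plane_lagrangian 4 \<mu> q (ptd I t \<tau>) (ptd I r \<tau>) (ptd I \<phi> \<tau>)) (r \<tau>))
          (at \<tau> within I)"
    using assms(2) \<tau> by (simp_all add: geodesic_with_def plane_geodesic_def)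
  have pos: "?f s > 0" "r s > 0" if "s \<in> I" for s
  proof -
    have "r s > 0" "(r s)\<^sup>2 > \<mu>"
      using assms(2) that by (simp_all add: geodesic_with_def plane_geodesic_def)
    then show "?f s > 0" "r s > 0" by (simp_all add: metric_factor_def)
  qed
  have r: "sqrt \<mu> < r \<tau>" using geo(1,2) assms(1)
    by (metis less_le real_less_lsqrt)
  have pt: "ptd I t \<tau> = E / ?f \<tau>" "ptd I \<phi> \<tau> = L / (r \<tau>)\<^sup>2"
    using assms(2) \<tau> pos[OF \<tau>]
    by (auto simp: geodesic_with_def energy_def angular_momentum_def field_simps)
  have en: "(?w \<tau>)\<^sup>2 + eff_potential 4 \<mu> L (r \<tau>) = E\<^sup>2"
    using energy_equation[OF assms(2) \<tau>] by simp
  have dr: "(r has_real_derivative ?w \<tau>) (at \<tau> within I)"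
    using ptd_has_derivative geo by blast
  have df: "(?f has_real_derivative 2 * \<mu> / (r \<tau>) ^ 3 * ?w \<tau>) (at \<tau> within I)"
    using DERIV_chain2[OF metric_factor_4_has_derivative dr] geo(1) by simp
  \<comment> \<open>The radius derivative of the Lagrangian, with the velocities of \<open>t\<close>
    and \<open>\<phi>\<close> expressed by \<open>E\<close> and \<open>L\<close>.\<close>
  define A where "A = - (2 * \<mu> / (r \<tau>) ^ 3) * (E / ?f \<tau>)\<^sup>2 -
      (2 * \<mu> / (r \<tau>) ^ 3) / (?f \<tau>)\<^sup>2 * (?w \<tau>)\<^sup>2 + 2 * r \<tau> * (L / (r \<tau>)\<^sup>2)\<^sup>2"
  have "((\<lambda>s. 2 * inverse (?f s) * ?w s) has_real_derivative A) (at \<tau> within I)"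
    using EL pos[OF \<tau>]
    by (simp add: deriv_plane_lagrangian_r deriv_plane_lagrangian_radius pt A_def)
  from DERIV_cdivide[OF DERIV_mult[OF df this], of 2]
  have "((\<lambda>s. ?f s * (2 * inverse (?f s) * ?w s) / 2) has_real_derivative D) (at \<tau> within I)"
    if "D = (2 * \<mu> / (r \<tau>) ^ 3 * ?w \<tau> * (2 * inverse (?f \<tau>) * ?w \<tau>) + A * ?f \<tau>) / 2" for D
    unfolding that .
  moreover have "radial_force \<mu> L (r \<tau>) =
      (2 * \<mu> / (r \<tau>) ^ 3 * ?w \<tau> * (2 * inverse (?f \<tau>) * ?w \<tau>) + A * ?f \<tau>) / 2"
  proof -
    have "radial_force \<mu> L (r \<tau>) = 2 * \<mu> / (r \<tau>) ^ 3 * (?w \<tau>)\<^sup>2 / ?f \<tau> + ?f \<tau> / 2 * A"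
      unfolding A_def
      by (rule radial_force_alt[OF _ refl _ en, symmetric]) (use pos[OF \<tau>] in auto)
    moreover have "k * v\<^sup>2 / f + f / 2 * B = (k * v * (2 * inverse f * v) + B * f) / 2"
      for k v f B :: real
      by (simp add: add_divide_distrib inverse_eq_divide power2_eq_square)
    ultimately show ?thesis by metis
  qed
  ultimately have
    "((\<lambda>s. ?f s * (2 * inverse (?f s) * ?w s) / 2) has_real_derivative radial_force \<mu> L (r \<tau>))
      (at \<tau> within I)" by blast
  then have "(?w has_real_derivative radial_force \<mu> L (r \<tau>)) (at \<tau> within I)"
    by (rule has_field_derivative_eq_on) (use \<tau> pos in \<open>auto simp: less_imp_neq[symmetric]\<close>)
  then show "sqrt \<mu> < r \<tau> \<and>
      (t has_real_derivative E / ?f \<tau>) (at \<tau> within I) \<and>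
      (\<phi> has_real_derivative L / (r \<tau>)\<^sup>2) (at \<tau> within I) \<and>
      (r has_real_derivative ?w \<tau>) (at \<tau> within I) \<and>
      (?w has_real_derivative radial_force \<mu> L (r \<tau>)) (at \<tau> within I) \<and>
      (?w \<tau>)\<^sup>2 + eff_potential 4 \<mu> L (r \<tau>) = E\<^sup>2"
    using r dr en geo ptd_has_derivative[of t \<tau> I] ptd_has_derivative[of \<phi> \<tau> I] by (simp add: pt)
qed

text \<open>The normalisation is the energy equation divided by the metric factor \<open>f\<close>,
  the momenta of the cyclic coordinates are the constants \<open>- 2 * E\<close> and
  \<open>2 * L\<close>, and the radial equation is the quotient rule for
  \<open>2 * w / f\<close>.\<close>

lemma geodesic_if_radial_motion:
  assumes "\<mu> > 0" "is_interval I" "interior I \<noteq> {}" and rm: "radial_motion \<mu> E L I t r \<phi> w"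
  shows "geodesic_with 4 \<mu> E L I t r \<phi>"
proof -
  let ?f = "\<lambda>s. metric_factor 4 \<mu> (r s)"
  have sol: "sqrt \<mu> < r \<tau>"
      "(t has_real_derivative E / ?f \<tau>) (at \<tau> within I)"
      "(\<phi> has_real_derivative L / (r \<tau>)\<^sup>2) (at \<tau> within I)"
      "(r has_real_derivative w \<tau>) (at \<tau> within I)"
      "(w has_real_derivative radial_force \<mu> L (r \<tau>)) (at \<tau> within I)"
      "(w \<tau>)\<^sup>2 + eff_potential 4 \<mu> L (r \<tau>) = E\<^sup>2" if "\<tau> \<in> I" for \<tau>
    using rm that unfolding radial_motion_def by blast+
  have r0: "r \<tau> > 0" if "\<tau> \<in> I" for \<tau>
    using sol(1)[OF that] assms(1) real_sqrt_gt_zero less_trans by blast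
  have f0: "?f \<tau> > 0" if "\<tau> \<in> I" for \<tau>
    using metric_factor_4_pos[OF assms(1) sol(1)[OF that]] .
  have pt: "ptd I t \<tau> = E / ?f \<tau>" "ptd I \<phi> \<tau> = L / (r \<tau>)\<^sup>2" "ptd I r \<tau> = w \<tau>" if "\<tau> \<in> I" for \<tau>
    using ptd_eq[OF assms(2,3) that] sol(2-4)[OF that] by auto
  have norm: "plane_lagrangian 4 \<mu> (r \<tau>) (ptd I t \<tau>) (ptd I r \<tau>) (ptd I \<phi> \<tau>) = -1"
    if "\<tau> \<in> I" for \<tau>
  proof -
    have "plane_lagrangian 4 \<mu> (r \<tau>) (ptd I t \<tau>) (ptd I r \<tau>) (ptd I \<phi> \<tau>) =
        ((w \<tau>)\<^sup>2 - E\<^sup>2) / ?f \<tau> + L\<^sup>2 / (r \<tau>)\<^sup>2"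
      using f0[OF that] r0[OF that]
      by (simp add: plane_lagrangian_def pt[OF that] power2_eq_square field_simps)
    also have "(w \<tau>)\<^sup>2 - E\<^sup>2 = - (L\<^sup>2 / (r \<tau>)\<^sup>2 + 1) * ?f \<tau>"
      using sol(6)[OF that] by (simp add: eff_potential_def algebra_simps)
    finally show ?thesis using f0[OF that] by simp
  qed
  have ELt: "((\<lambda>s. deriv (\<lambda>v. plane_lagrangian 4 \<mu> (r s) v (ptd I r s) (ptd I \<phi> s)) (ptd I t s))
      has_real_derivative 0) (at \<tau> within I)" if "\<tau> \<in> I" for \<tau>
    by (rule has_field_derivative_eq_on[OF DERIV_const[of "- 2 * E"] that])
       (use f0 in \<open>force simp: deriv_plane_lagrangian_t pt\<close>)
  have ELp: "((\<lambda>s. deriv (\<lambda>v. plane_lagrangian 4 \<mu> (r s) (ptd I t s) (ptd I r s) v) (ptd I \<phi> s))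
      has_real_derivative 0) (at \<tau> within I)" if "\<tau> \<in> I" for \<tau>
    by (rule has_field_derivative_eq_on[OF DERIV_const[of "2 * L"] that])
       (use r0 in \<open>force simp: deriv_plane_lagrangian_phi pt\<close>)
  have ELr: "((\<lambda>s. deriv (\<lambda>v. plane_lagrangian 4 \<mu> (r s) (ptd I t s) v (ptd I \<phi> s)) (ptd I r s))
      has_real_derivative
      deriv (\<lambda>q. plane_lagrangian 4 \<mu> q (ptd I t \<tau>) (ptd I r \<tau>) (ptd I \<phi> \<tau>)) (r \<tau>))
      (at \<tau> within I)" if \<tau>: "\<tau> \<in> I" for \<tau>
  proof -
    define A where "A = - (2 * \<mu> / (r \<tau>) ^ 3) * (E / ?f \<tau>)\<^sup>2 -
      (2 * \<mu> / (r \<tau>) ^ 3) / (?f \<tau>)\<^sup>2 * (w \<tau>)\<^sup>2 + 2 * r \<tau> * (L / (r \<tau>)\<^sup>2)\<^sup>2"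
    have df: "(?f has_real_derivative 2 * \<mu> / (r \<tau>) ^ 3 * w \<tau>) (at \<tau> within I)"
      using DERIV_chain2[OF metric_factor_4_has_derivative sol(4)[OF \<tau>]] r0[OF \<tau>] by simp
    have F: "radial_force \<mu> L (r \<tau>) = (2 * \<mu> / (r \<tau>) ^ 3) * (w \<tau>)\<^sup>2 / ?f \<tau> + ?f \<tau> / 2 * A"
      unfolding A_def using radial_force_alt[OF r0[OF \<tau>] refl _ sol(6)[OF \<tau>]] f0[OF \<tau>] by simp
    have "((\<lambda>s. 2 * w s / ?f s) has_real_derivative
       (2 * radial_force \<mu> L (r \<tau>) * ?f \<tau> - 2 * w \<tau> * (2 * \<mu> / (r \<tau>) ^ 3 * w \<tau>)) / (?f \<tau> * ?f \<tau>))
       (at \<tau> within I)"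
      using f0[OF \<tau>] by (intro DERIV_divide DERIV_cmult sol(5)[OF \<tau>] df) simp
    also have "(2 * radial_force \<mu> L (r \<tau>) * ?f \<tau> - 2 * w \<tau> * (2 * \<mu> / (r \<tau>) ^ 3 * w \<tau>)) /
        (?f \<tau> * ?f \<tau>) = A"
      unfolding F using f0[OF \<tau>] by (simp add: power2_eq_square field_simps)
    also have "A = deriv (\<lambda>q. plane_lagrangian 4 \<mu> q (ptd I t \<tau>) (ptd I r \<tau>) (ptd I \<phi> \<tau>)) (r \<tau>)"
      using f0[OF \<tau>] r0[OF \<tau>] by (simp add: deriv_plane_lagrangian_radius pt[OF \<tau>] A_def)
    finally show ?thesis
      by (rule has_field_derivative_eq_on[OF _ \<tau>])
         (simp add: deriv_plane_lagrangian_r pt divide_inverse)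
  qed
  have diff: "t differentiable (at \<tau> within I)" "r differentiable (at \<tau> within I)"
    "\<phi> differentiable (at \<tau> within I)" if "\<tau> \<in> I" for \<tau>
    using sol(2-4)[OF that] by (auto simp: real_differentiable_def)
  have mu: "r \<tau> ^ 2 > \<mu>" if "\<tau> \<in> I" for \<tau>
    using f0[OF that] r0[OF that] by (simp add: metric_factor_def)
  have cons: "energy 4 \<mu> I t r \<tau> = E" "angular_momentum I r \<phi> \<tau> = L" if "\<tau> \<in> I" for \<tau>
    using f0[OF that] r0[OF that] by (auto simp: energy_def angular_momentum_def pt[OF that])
  show ?thesis
    unfolding geodesic_with_def plane_geodesic_def
    using assms(2,3) norm ELt ELp ELr diff mu cons r0 by simp
qed

section \<open>Radial motion\<close>

lemma radial_motionD:
  assumes "radial_motion \<mu> E L I t r \<phi> w" "\<tau> \<in> I"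
  shows "sqrt \<mu> < r \<tau>"
    "(t has_real_derivative E / metric_factor 4 \<mu> (r \<tau>)) (at \<tau> within I)"
    "(\<phi> has_real_derivative L / (r \<tau>)\<^sup>2) (at \<tau> within I)"
    "(r has_real_derivative w \<tau>) (at \<tau> within I)"
    "(w has_real_derivative radial_force \<mu> L (r \<tau>)) (at \<tau> within I)"
    "(w \<tau>)\<^sup>2 + eff_potential 4 \<mu> L (r \<tau>) = E\<^sup>2"
  using assms unfolding radial_motion_def by blast+

lemma radial_motion_subset:
  assumes "radial_motion \<mu> E L I t r \<phi> w" "J \<subseteq> I"
  shows "radial_motion \<mu> E L J t r \<phi> w"
  using assms unfolding radial_motion_def by (blast intro: DERIV_subset)

lemma radial_motion_continuous:
  assumes "radial_motion \<mu> E L I t r \<phi> w"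
  shows "continuous_on I r" "continuous_on I w"
  by (rule DERIV_continuous_on, erule radial_motionD(4,5)[OF assms])+

lemma radial_motion_radius_pos:
  assumes "\<mu> > 0" "radial_motion \<mu> E L I t r \<phi> w" "\<tau> \<in> I"
  shows "r \<tau> > 0"
  using radial_motionD(1)[OF assms(2,3)] assms(1) real_sqrt_gt_zero less_trans by blast

lemma eff_potential_4_deriv:
  assumes "r \<noteq> 0"
  shows "(eff_potential 4 \<mu> L has_real_derivative - 2 * radial_force \<mu> L r) (at r)"
  using eff_potential_4_has_derivative[OF assms, of \<mu> L] by (simp add: radial_force_def)

lemma continuous_on_eff_potential_4:
  assumes "S \<subseteq> {0<..}"
  shows "continuous_on S (eff_potential 4 \<mu> L)"
  using assms
  by (intro continuous_at_imp_continuous_on ballI DERIV_isCont[OF eff_potential_4_deriv]) auto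

lemma continuous_on_radial_force:
  assumes "S \<subseteq> {0<..}"
  shows "continuous_on S (radial_force \<mu> L)"
  unfolding radial_force_def[abs_def] using assms by (auto intro!: continuous_intros)

lemma continuous_on_metric_factor_4:
  assumes "S \<subseteq> {0<..}"
  shows "continuous_on S (metric_factor 4 \<mu>)"
  unfolding metric_factor_def[abs_def] using assms by (auto intro!: continuous_intros)

section \<open>Bounds on velocity and duration\<close>

text \<open>Outside the sphere both factors of the potential are positive, so the energy equation
  leaves at most \<open>E\<^sup>2\<close> for the square of the velocity.\<close>

lemma radial_velocity_bound:
  assumes "\<mu> > 0" "radial_motion \<mu> E L I t r \<phi> w" "\<tau> \<in> I"
  shows "\<bar>w \<tau>\<bar> \<le> \<bar>E\<bar>"
proof -
  have "eff_potential 4 \<mu> L (r \<tau>) \<ge> 0"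
    using metric_factor_4_pos[OF assms(1) radial_motionD(1)[OF assms(2,3)]]
    by (simp add: eff_potential_def)
  with radial_motionD(6)[OF assms(2,3)] show ?thesis
    by (simp add: abs_le_square_iff)
qed

text \<open>By the mean value theorem the velocity changes by at least \<open>c * (b - a)\<close> in
  the direction \<open>s\<close>, but it always lies between \<open>- \<bar>E\<bar>\<close> and
  \<open>\<bar>E\<bar>\<close>.\<close>

lemma radial_motion_duration_bound:
  assumes "\<mu> > 0" "radial_motion \<mu> E L I t r \<phi> w" "is_interval I" "a \<in> I" "b \<in> I" "a \<le> b"
    and s: "s = 1 \<or> s = -1" and c: "\<And>\<tau>. \<tau> \<in> I \<Longrightarrow> c \<le> s * radial_force \<mu> L (r \<tau>)"
  shows "c * (b - a) \<le> 2 * \<bar>E\<bar>"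
proof (cases "a < b")
  case True
  obtain z where z: "z \<in> I" "w b - w a = (b - a) * radial_force \<mu> L (r z)"
    using mvt_within_interval[OF assms(3-5) True radial_motionD(5)[OF assms(2)]] by blast
  have "c * (b - a) \<le> s * radial_force \<mu> L (r z) * (b - a)"
    using c[OF z(1)] True by simp
  also have "\<dots> = s * (w b - w a)"
    by (simp add: z(2))
  also have "\<dots> \<le> 2 * \<bar>E\<bar>"
    using s radial_velocity_bound[OF assms(1,2,4)] radial_velocity_bound[OF assms(1,2,5)] by auto
  finally show ?thesis .
qed (use assms(6) in auto)

text \<open>A continuous force without zeros on a compact set is bounded away from zero, and along
  the motion it has constant sign; this bounds the duration.\<close>

lemma no_eternal_motion_without_critical_point:
  assumes "\<mu> > 0" and rm: "radial_motion \<mu> E L {a..} t r \<phi> w"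
    and K: "compact K" "K \<subseteq> {0<..}" "\<And>\<tau>. \<tau> \<ge> a \<Longrightarrow> r \<tau> \<in> K"
    and crit: "\<And>x. x \<in> K \<Longrightarrow> radial_force \<mu> L x \<noteq> 0"
  shows False
proof -
  have "K \<noteq> {}" using K(3)[of a] by auto
  moreover have "continuous_on K (\<lambda>x. \<bar>radial_force \<mu> L x\<bar>)"
    by (intro continuous_intros continuous_on_radial_force K(2))
  ultimately obtain x0 where x0: "x0 \<in> K"
      "\<And>x. x \<in> K \<Longrightarrow> \<bar>radial_force \<mu> L x0\<bar> \<le> \<bar>radial_force \<mu> L x\<bar>"
    using continuous_attains_inf[OF K(1)] by metis
  define c where "c = \<bar>radial_force \<mu> L x0\<bar>"
  have "c > 0" using crit[OF x0(1)] by (simp add: c_def)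
  let ?f = "\<lambda>\<tau>. radial_force \<mu> L (r \<tau>)"
  \<comment> \<open>The values of the force along the motion form an interval; as it omits zero,
    they all have the same sign.\<close>
  have "continuous_on {a..} ?f"
    using K by (intro continuous_on_compose2[OF continuous_on_radial_force
          radial_motion_continuous(1)[OF rm]]) auto
  then have "connected (?f ` {a..})"
    by (intro connected_continuous_image) auto
  then have int: "is_interval (?f ` {a..})"
    by (simp add: is_interval_connected_1)
  have f0: "?f \<tau> \<noteq> 0" "c \<le> \<bar>?f \<tau>\<bar>" if "\<tau> \<ge> a" for \<tau>
    using crit K(3)[OF that] x0(2) by (auto simp: c_def)
  have "\<exists>s. (s = 1 \<or> s = -1) \<and> (\<forall>\<tau>\<ge>a. c \<le> s * ?f \<tau>)"
  proof (cases "\<exists>\<tau>\<ge>a. ?f \<tau> > 0")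
    case True
    then obtain \<tau>1 where \<tau>1: "\<tau>1 \<ge> a" "?f \<tau>1 > 0" by blast
    have "?f \<tau> > 0" if "\<tau> \<ge> a" for \<tau>
    proof (rule ccontr)
      assume "\<not> ?f \<tau> > 0"
      then have "0 \<in> ?f ` {a..}"
        using mem_is_interval_1_I[OF int, of "?f \<tau>" "?f \<tau>1" 0] that \<tau>1 by auto
      with f0 show False by force
    qed
    with f0(2) show ?thesis by (intro exI[of _ 1]) force
  next
    case False
    with f0 show ?thesis by (intro exI[of _ "-1"]) (force simp: not_less abs_if)
  qed
  then obtain s where s: "s = 1 \<or> s = -1" "\<And>\<tau>. \<tau> \<in> {a..} \<Longrightarrow> c \<le> s * ?f \<tau>"
    by auto
  \<comment> \<open>At this time the duration bound would read
    \<open>2 * \<bar>E\<bar> + 1 \<le> 2 * \<bar>E\<bar>\<close>.\<close>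
  have "c * ((a + (2 * \<bar>E\<bar> + 1) / c) - a) \<le> 2 * \<bar>E\<bar>"
    by (rule radial_motion_duration_bound[OF assms(1) rm _ _ _ _ s])
       (use \<open>c > 0\<close> in \<open>auto simp: is_interval_1\<close>)
  with \<open>c > 0\<close> show False by simp
qed

section \<open>Pasting, reflecting and constructing motions\<close>

lemma has_field_derivative_If:
  fixes f g :: "real \<Rightarrow> real"
  assumes "\<And>x. x \<in> {a..m} \<Longrightarrow> (f has_real_derivative f' x) (at x within {a..m})"
    and "\<And>x. x \<in> {m..b} \<Longrightarrow> (g has_real_derivative g' x) (at x within {m..b})"
    and "f m = g m" "f' m = g' m" "a \<le> m" "m \<le> b" "x \<in> {a..b}"
  shows "((\<lambda>x. if x \<le> m then f x else g x) has_real_derivative (if x \<le> m then f' x else g' x))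
    (at x within {a..b})"
proof -
  let ?h = "\<lambda>x. if x \<le> m then f x else g x" and ?D = "if x \<le> m then f' x else g' x"
  have "(?h has_real_derivative ?D) (at x within ({a..m} \<union> {m..b}))"
  proof (rule has_field_derivative_paste)
    assume x: "x \<in> {a..m}"
    show "(?h has_real_derivative ?D) (at x within {a..m})"
      by (rule has_field_derivative_eq_on[of f]) (use assms(1)[OF x] x in auto)
  next
    assume x: "x \<in> {m..b}"
    have "(?h has_real_derivative g' x) (at x within {m..b})"
      by (rule has_field_derivative_eq_on[OF assms(2)[OF x] x]) (use assms(3) in auto)
    moreover have "?D = g' x" using x assms(4) by auto
    ultimately show "(?h has_real_derivative ?D) (at x within {m..b})" by (simp only:)
  qed (use assms in auto)
  moreover have "{a..m} \<union> {m..b} = {a..b}" using assms by auto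
  ultimately show ?thesis by simp
qed

text \<open>It suffices to match coordinates and radial velocity: the derivatives of
  \<open>t\<close>, \<open>\<phi>\<close> and \<open>w\<close> are functions of the radius, so they
  agree at \<open>m\<close> as well.\<close>

lemma radial_motion_paste:
  assumes 1: "radial_motion \<mu> E L {a..m} t1 r1 \<phi>1 w1" and 2: "radial_motion \<mu> E L {m..b} t2 r2 \<phi>2 w2"
    and m: "t1 m = t2 m" "r1 m = r2 m" "\<phi>1 m = \<phi>2 m" "w1 m = w2 m" "a \<le> m" "m \<le> b"
  shows "radial_motion \<mu> E L {a..b} (\<lambda>\<tau>. if \<tau> \<le> m then t1 \<tau> else t2 \<tau>)
    (\<lambda>\<tau>. if \<tau> \<le> m then r1 \<tau> else r2 \<tau>) (\<lambda>\<tau>. if \<tau> \<le> m then \<phi>1 \<tau> else \<phi>2 \<tau>)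
    (\<lambda>\<tau>. if \<tau> \<le> m then w1 \<tau> else w2 \<tau>)"
  unfolding radial_motion_def
proof (intro ballI conjI)
  fix \<tau> assume \<tau>: "\<tau> \<in> {a..b}"
  note D1 = radial_motionD[OF 1] and D2 = radial_motionD[OF 2]
  have if_arg: "g (if \<tau> \<le> m then r1 \<tau> else r2 \<tau>) = (if \<tau> \<le> m then g (r1 \<tau>) else g (r2 \<tau>))"
    for g :: "real \<Rightarrow> real" by simp
  show "sqrt \<mu> < (if \<tau> \<le> m then r1 \<tau> else r2 \<tau>)"
    using D1(1) D2(1) \<tau> by auto
  show "(if \<tau> \<le> m then w1 \<tau> else w2 \<tau>)\<^sup>2 + eff_potential 4 \<mu> L (if \<tau> \<le> m then r1 \<tau> else r2 \<tau>) = E\<^sup>2"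
    using D1(6) D2(6) \<tau> by auto
  show "((\<lambda>\<tau>. if \<tau> \<le> m then t1 \<tau> else t2 \<tau>) has_real_derivative
      E / metric_factor 4 \<mu> (if \<tau> \<le> m then r1 \<tau> else r2 \<tau>)) (at \<tau> within {a..b})"
    using has_field_derivative_If[OF D1(2) D2(2) m(1) _ m(5,6) \<tau>] m(2)
    by (subst if_arg[of "\<lambda>r. E / metric_factor 4 \<mu> r"]) simp
  show "((\<lambda>\<tau>. if \<tau> \<le> m then \<phi>1 \<tau> else \<phi>2 \<tau>) has_real_derivative
      L / (if \<tau> \<le> m then r1 \<tau> else r2 \<tau>)\<^sup>2) (at \<tau> within {a..b})"
    using has_field_derivative_If[OF D1(3) D2(3) m(3) _ m(5,6) \<tau>] m(2)
    by (subst if_arg[of "\<lambda>r. L / r\<^sup>2"]) simp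
  show "((\<lambda>\<tau>. if \<tau> \<le> m then r1 \<tau> else r2 \<tau>) has_real_derivative
      (if \<tau> \<le> m then w1 \<tau> else w2 \<tau>)) (at \<tau> within {a..b})"
    using has_field_derivative_If[OF D1(4) D2(4) m(2) m(4) m(5,6) \<tau>] .
  show "((\<lambda>\<tau>. if \<tau> \<le> m then w1 \<tau> else w2 \<tau>) has_real_derivative
      radial_force \<mu> L (if \<tau> \<le> m then r1 \<tau> else r2 \<tau>)) (at \<tau> within {a..b})"
    using has_field_derivative_If[OF D1(5) D2(5) m(4) _ m(5,6) \<tau>] m(2)
    by (subst if_arg[of "radial_force \<mu> L"]) simp
qed

text \<open>Time reversal flips the velocity and keeps the force. Reflecting also the values of
  \<open>t\<close> and \<open>\<phi>\<close> preserves the signs of \<open>E\<close> and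
  \<open>L\<close>. The result continues the original motion when \<open>w m = 0\<close>.\<close>

lemma radial_motion_reflect:
  assumes "radial_motion \<mu> E L {a..m} t r \<phi> w"
  shows "radial_motion \<mu> E L {m..2 * m - a} (\<lambda>\<tau>. 2 * t m - t (2 * m - \<tau>)) (\<lambda>\<tau>. r (2 * m - \<tau>))
    (\<lambda>\<tau>. 2 * \<phi> m - \<phi> (2 * m - \<tau>)) (\<lambda>\<tau>. - w (2 * m - \<tau>))"
  unfolding radial_motion_def
proof (intro ballI)
  fix \<tau> assume "\<tau> \<in> {m..2 * m - a}"
  then have \<tau>: "2 * m - \<tau> \<in> {a..m}" by auto
  have img: "(\<lambda>\<tau>. 2 * m - \<tau>) ` {m..2 * m - a} \<subseteq> {a..m}" by auto
  have chain: "((\<lambda>\<tau>. f (2 * m - \<tau>)) has_real_derivative - D) (at \<tau> within {m..2 * m - a})"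
    if "(f has_real_derivative D) (at (2 * m - \<tau>) within {a..m})" for f D
  proof -
    have "((\<lambda>\<tau>. 2 * m - \<tau>) has_real_derivative -1) (at \<tau> within {m..2 * m - a})"
      by (auto intro!: derivative_eq_intros)
    from DERIV_image_chain[OF DERIV_subset[OF that img] this] show ?thesis
      by (simp add: o_def)
  qed
  note D = radial_motionD[OF assms \<tau>]
  show "sqrt \<mu> < r (2 * m - \<tau>) \<and>
      ((\<lambda>\<tau>. 2 * t m - t (2 * m - \<tau>)) has_real_derivative E / metric_factor 4 \<mu> (r (2 * m - \<tau>)))
        (at \<tau> within {m..2 * m - a}) \<and>
      ((\<lambda>\<tau>. 2 * \<phi> m - \<phi> (2 * m - \<tau>)) has_real_derivative L / (r (2 * m - \<tau>))\<^sup>2)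
        (at \<tau> within {m..2 * m - a}) \<and>
      ((\<lambda>\<tau>. r (2 * m - \<tau>)) has_real_derivative - w (2 * m - \<tau>)) (at \<tau> within {m..2 * m - a}) \<and>
      ((\<lambda>\<tau>. - w (2 * m - \<tau>)) has_real_derivative radial_force \<mu> L (r (2 * m - \<tau>)))
        (at \<tau> within {m..2 * m - a}) \<and>
      (- w (2 * m - \<tau>))\<^sup>2 + eff_potential 4 \<mu> L (r (2 * m - \<tau>)) = E\<^sup>2"
    using D(1,6) DERIV_diff[OF DERIV_const chain[OF D(2)], of "2 * t m"]
      DERIV_diff[OF DERIV_const chain[OF D(3)], of "2 * \<phi> m"] chain[OF D(4)]
      DERIV_minus[OF chain[OF D(5)]] by simp
qed

text \<open>The sign \<open>s\<close> is that of the radial velocity, so that \<open>s * r\<close> increases from \<open>a\<close>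
  to \<open>b\<close> whatever the direction of the motion.\<close>

lemma radial_motion_by_quadrature:
  assumes "\<mu> > 0" and s: "s = 1 \<or> s = -1" and "a < b"
    and V: "\<And>x. x \<in> {a..b} \<Longrightarrow> sqrt \<mu> < s * x" "\<And>x. x \<in> {a..b} \<Longrightarrow> eff_potential 4 \<mu> L (s * x) < E\<^sup>2"
  obtains T t r \<phi> w where "T0 < T" "radial_motion \<mu> E L {T0..T} t r \<phi> w"
    "t T0 = t0" "\<phi> T0 = \<phi>0" "r T0 = s * a" "r T = s * b"
    "w T0 = s * sqrt (E\<^sup>2 - eff_potential 4 \<mu> L (s * a))"
proof -
  have "sqrt \<mu> > 0" using assms(1) by simp
  define g where "g x = sqrt (E\<^sup>2 - eff_potential 4 \<mu> L (s * x))" for x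
  have "continuous_on {a..b} (\<lambda>x. eff_potential 4 \<mu> L (s * x))"
    using less_trans[OF \<open>sqrt \<mu> > 0\<close> V(1)]
    by (intro continuous_on_compose2[OF continuous_on_eff_potential_4[OF order_refl]])
       (auto intro!: continuous_intros)
  then have "continuous_on {a..b} g"
    unfolding g_def by (intro continuous_intros)
  moreover have gpos: "g x > 0" if "x \<in> {a..b}" for x
    using V(2)[OF that] by (simp add: g_def)
  ultimately obtain T y where y: "T0 < T" "y T0 = a" "y T = b" "\<And>\<tau>. \<tau> \<in> {T0..T} \<Longrightarrow> y \<tau> \<in> {a..b}"
    "\<And>\<tau>. \<tau> \<in> {T0..T} \<Longrightarrow> (y has_real_derivative g (y \<tau>)) (at \<tau> within {T0..T})"
    using autonomous_ode_solution[OF \<open>a < b\<close>, of g T0] by blast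
  define r where "r \<tau> = s * y \<tau>" for \<tau>
  define w where "w \<tau> = s * g (y \<tau>)" for \<tau>
  have ss: "s * s = 1" using s by auto
  have r: "sqrt \<mu> < r \<tau>" "r \<tau> > 0" if "\<tau> \<in> {T0..T}" for \<tau>
    using V(1)[OF y(4)[OF that]] less_trans[OF \<open>sqrt \<mu> > 0\<close> V(1)[OF y(4)[OF that]]]
    by (simp_all add: r_def)
  have dr: "(r has_real_derivative w \<tau>) (at \<tau> within {T0..T})" if "\<tau> \<in> {T0..T}" for \<tau>
    unfolding r_def w_def by (intro DERIV_cmult y(5) that)
  \<comment> \<open>The derivative of the square root brings the reciprocal of the speed, which
    cancels against the velocity because the radicand is positive and
    \<open>s * s = 1\<close>.\<close>
  have dw: "(w has_real_derivative radial_force \<mu> L (r \<tau>)) (at \<tau> within {T0..T})"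
    if \<tau>: "\<tau> \<in> {T0..T}" for \<tau>
  proof -
    have "((\<lambda>\<tau>. eff_potential 4 \<mu> L (r \<tau>)) has_real_derivative - 2 * radial_force \<mu> L (r \<tau>) * w \<tau>)
        (at \<tau> within {T0..T})"
      using r[OF \<tau>] by (intro DERIV_chain2[OF eff_potential_4_deriv dr[OF \<tau>]]) simp
    from DERIV_diff[OF DERIV_const this, of "E\<^sup>2"]
    have dU: "((\<lambda>\<tau>. E\<^sup>2 - eff_potential 4 \<mu> L (r \<tau>)) has_real_derivative
        2 * radial_force \<mu> L (r \<tau>) * w \<tau>) (at \<tau> within {T0..T})" by simp
    have "E\<^sup>2 - eff_potential 4 \<mu> L (r \<tau>) > 0"
      using V(2)[OF y(4)[OF \<tau>]] by (simp add: r_def)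
    from DERIV_cmult[OF DERIV_chain2[OF DERIV_real_sqrt[OF this] dU], of s]
    have "((\<lambda>\<tau>. s * sqrt (E\<^sup>2 - eff_potential 4 \<mu> L (r \<tau>))) has_real_derivative
        s * (inverse (sqrt (E\<^sup>2 - eff_potential 4 \<mu> L (r \<tau>))) / 2 *
          (2 * radial_force \<mu> L (r \<tau>) * w \<tau>))) (at \<tau> within {T0..T})" .
    moreover have "s * (inverse (sqrt (E\<^sup>2 - eff_potential 4 \<mu> L (r \<tau>))) / 2 *
          (2 * radial_force \<mu> L (r \<tau>) * w \<tau>)) = radial_force \<mu> L (r \<tau>)"
    proof -
      have "s * (inverse v / 2 * (2 * F * (s * v))) = F" if "v > 0" for F v :: real
        using ss that by (simp add: field_simps)
      from this[OF gpos[OF y(4)[OF \<tau>]]] show ?thesis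
        by (simp add: w_def g_def r_def)
    qed
    ultimately have "((\<lambda>\<tau>. s * sqrt (E\<^sup>2 - eff_potential 4 \<mu> L (r \<tau>))) has_real_derivative
        radial_force \<mu> L (r \<tau>)) (at \<tau> within {T0..T})" by (simp only:)
    moreover have "w = (\<lambda>\<tau>. s * sqrt (E\<^sup>2 - eff_potential 4 \<mu> L (r \<tau>)))"
      by (simp add: fun_eq_iff w_def g_def r_def)
    ultimately show ?thesis by (simp only:)
  qed
  have cr: "continuous_on {T0..T} r" by (rule DERIV_continuous_on[OF dr])
  have f: "metric_factor 4 \<mu> (r \<tau>) > 0" if "\<tau> \<in> {T0..T}" for \<tau>
    using metric_factor_4_pos[OF assms(1) r(1)[OF that]] .
  have "continuous_on {T0..T} (\<lambda>\<tau>. E / metric_factor 4 \<mu> (r \<tau>))"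
    using f r(2) by (intro continuous_intros continuous_on_compose2[OF
        continuous_on_metric_factor_4[OF order_refl] cr]) (auto simp: less_imp_neq[symmetric])
  then obtain t where t: "t T0 = t0" "\<And>\<tau>. \<tau> \<in> {T0..T} \<Longrightarrow>
      (t has_real_derivative E / metric_factor 4 \<mu> (r \<tau>)) (at \<tau> within {T0..T})"
    by (rule real_antiderivative_on_interval[where c = t0]) blast
  have "continuous_on {T0..T} (\<lambda>\<tau>. L / (r \<tau>)\<^sup>2)"
    using r(2) by (intro continuous_intros cr) (force)
  then obtain \<phi> where \<phi>: "\<phi> T0 = \<phi>0" "\<And>\<tau>. \<tau> \<in> {T0..T} \<Longrightarrow>
      (\<phi> has_real_derivative L / (r \<tau>)\<^sup>2) (at \<tau> within {T0..T})"
    by (rule real_antiderivative_on_interval[where c = \<phi>0]) blast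
  have "(w \<tau>)\<^sup>2 + eff_potential 4 \<mu> L (r \<tau>) = E\<^sup>2" if "\<tau> \<in> {T0..T}" for \<tau>
    using V(2)[OF y(4)[OF that]] ss
    by (simp add: w_def g_def r_def power_mult_distrib power2_eq_square[of s])
  then have "radial_motion \<mu> E L {T0..T} t r \<phi> w"
    unfolding radial_motion_def using r dr dw t(2) \<phi>(2) by blast
  from that[OF y(1) this t(1) \<phi>(1)] y(2,3) show ?thesis
    by (simp add: r_def w_def g_def)
qed

section \<open>Continuation to and past the end of the time interval\<close>

text \<open>The Lipschitz function \<open>r\<close> extends first, which makes the force continuous
  up to \<open>T\<close>; then \<open>w\<close> extends as its primitive. The coordinate
  \<open>t\<close> is left out because the limit may lie on the sphere, where the metric factor
  vanishes.\<close>

lemma radial_motion_extends_to_right_end: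
  assumes "\<mu> > 0" "0 < T" and rm: "radial_motion \<mu> E L {0..<T} t r \<phi> w"
  obtains r' w' where "\<And>\<tau>. \<tau> \<in> {0..<T} \<Longrightarrow> r' \<tau> = r \<tau>" "\<And>\<tau>. \<tau> \<in> {0..<T} \<Longrightarrow> w' \<tau> = w \<tau>"
    "\<And>\<tau>. \<tau> \<in> {0..T} \<Longrightarrow> (r' has_real_derivative w' \<tau>) (at \<tau> within {0..T})"
    "\<And>\<tau>. \<tau> \<in> {0..T} \<Longrightarrow> (w' has_real_derivative radial_force \<mu> L (r' \<tau>)) (at \<tau> within {0..T})"
    "\<And>\<tau>. \<tau> \<in> {0..T} \<Longrightarrow> (w' \<tau>)\<^sup>2 + eff_potential 4 \<mu> L (r' \<tau>) = E\<^sup>2"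
    "sqrt \<mu> \<le> r' T" "(r \<longlongrightarrow> r' T) (at_left T)"
proof -
  have "sqrt \<mu> > 0" using assms(1) by simp
  note D = radial_motionD[OF rm]
  obtain r' where r': "continuous_on {0..T} r'" "\<And>\<tau>. \<tau> \<in> {0..<T} \<Longrightarrow> r' \<tau> = r \<tau>"
    using bounded_derivative_extends_continuously[OF \<open>0 < T\<close> D(4) radial_velocity_bound[OF assms(1) rm]]
    by blast
  have "(r' \<longlongrightarrow> r' T) (at_left T)"
    using r'(1) \<open>0 < T\<close> by (simp add: continuous_on_Icc_at_leftD)
  moreover have "\<forall>\<^sub>F \<tau> in at_left T. r' \<tau> = r \<tau> \<and> sqrt \<mu> < r \<tau>"
    using eventually_at_left_real[OF \<open>0 < T\<close>]
    by eventually_elim (use r'(2) D(1) in auto)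
  ultimately have lim: "(r \<longlongrightarrow> r' T) (at_left T)" and ev: "\<forall>\<^sub>F \<tau> in at_left T. sqrt \<mu> \<le> r \<tau>"
    by (auto intro: Lim_transform_eventually elim: eventually_mono)
  have "sqrt \<mu> \<le> r' T"
    by (rule tendsto_lowerbound[OF lim ev]) simp
  then have r'_ge: "sqrt \<mu> \<le> r' \<tau>" if "\<tau> \<in> {0..T}" for \<tau>
    using that r'(2)[of \<tau>] D(1)[of \<tau>] by (cases "\<tau> = T") auto
  then have r'_pos: "0 < r' \<tau>" if "\<tau> \<in> {0..T}" for \<tau>
    using less_le_trans[OF \<open>sqrt \<mu> > 0\<close>] that by blast
  have "continuous_on {0..T} (\<lambda>\<tau>. radial_force \<mu> L (r' \<tau>))"
    using r'_pos by (intro continuous_on_compose2[OF continuous_on_radial_force[OF order_refl] r'(1)]) auto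
  moreover have "(w has_real_derivative radial_force \<mu> L (r' \<tau>)) (at \<tau> within {0..<T})"
    if "\<tau> \<in> {0..<T}" for \<tau>
    using D(5)[OF that] r'(2)[OF that] by simp
  ultimately obtain w' where w': "\<And>\<tau>. \<tau> \<in> {0..<T} \<Longrightarrow> w' \<tau> = w \<tau>"
    "\<And>\<tau>. \<tau> \<in> {0..T} \<Longrightarrow> (w' has_real_derivative radial_force \<mu> L (r' \<tau>)) (at \<tau> within {0..T})"
    using primitive_extends_to_right_end[OF \<open>0 < T\<close>, of w "\<lambda>\<tau>. radial_force \<mu> L (r' \<tau>)"] by blast
  have cw: "continuous_on {0..T} w'" by (rule DERIV_continuous_on[OF w'(2)])
  moreover have "(r has_real_derivative w' \<tau>) (at \<tau> within {0..<T})" if "\<tau> \<in> {0..<T}" for \<tau>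
    using D(4)[OF that] w'(1)[OF that] by simp
  \<comment> \<open>A second extension of the radius, as a primitive of \<open>w'\<close>, has a
    derivative at \<open>T\<close>; by continuity it coincides with \<open>r'\<close>.\<close>
  ultimately obtain r'' where r'': "\<And>\<tau>. \<tau> \<in> {0..<T} \<Longrightarrow> r'' \<tau> = r \<tau>"
    "\<And>\<tau>. \<tau> \<in> {0..T} \<Longrightarrow> (r'' has_real_derivative w' \<tau>) (at \<tau> within {0..T})"
    using primitive_extends_to_right_end[OF \<open>0 < T\<close>] by metis
  have "continuous_on {0..T} r''" by (rule DERIV_continuous_on[OF r''(2)])
  then have eq: "r'' \<tau> = r' \<tau>" if "\<tau> \<in> {0..T}" for \<tau>
    using eq_at_right_end_if_eq_before[OF \<open>0 < T\<close> _ r'(1) _ that] r'(2) r''(1) by metis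
  have dr: "(r' has_real_derivative w' \<tau>) (at \<tau> within {0..T})" if "\<tau> \<in> {0..T}" for \<tau>
    by (rule has_field_derivative_eq_on[OF r''(2)[OF that] that eq])
  have "continuous_on {0..T} (\<lambda>\<tau>. (w' \<tau>)\<^sup>2 + eff_potential 4 \<mu> L (r' \<tau>))"
    using r'_pos by (intro continuous_intros cw continuous_on_compose2[OF
        continuous_on_eff_potential_4[OF order_refl] r'(1)]) auto
  then have "(w' \<tau>)\<^sup>2 + eff_potential 4 \<mu> L (r' \<tau>) = E\<^sup>2" if "\<tau> \<in> {0..T}" for \<tau>
    by (rule eq_at_right_end_if_eq_before[OF \<open>0 < T\<close> _ continuous_on_const _ that])
       (use D(6) r'(2) w'(1) in auto)
  from that[OF r'(2) w'(1) dr w'(2) this \<open>sqrt \<mu> \<le> r' T\<close> lim] show ?thesis by blast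
qed

text \<open>The final state lies strictly outside the sphere, so the motion can be continued: by
  reflection if the velocity vanishes there, and by quadrature otherwise.\<close>

lemma not_inextendible_at_closed_end:
  assumes "\<mu> > 0" "T > 0" and geo: "geodesic_with 4 \<mu> E L {0..T} t r \<phi>"
    and inext: "future_inextendible 4 \<mu> {0..T} t r \<phi>"
  shows False
proof -
  obtain w where rm: "radial_motion \<mu> E L {0..T} t r \<phi> w"
    using radial_motion_if_geodesic[OF assms(1) geo] by blast
  have T: "T \<in> {0..T}" using assms(2) by simp
  note D = radial_motionD[OF rm T]
  \<comment> \<open>Any motion starting at \<open>T\<close> in the final state can be pasted on,
    which contradicts inextendibility.\<close>
  have no_cont: False if "T < T'" "radial_motion \<mu> E L {T..T'} t2 r2 \<phi>2 w2"
    "t T = t2 T" "r T = r2 T" "\<phi> T = \<phi>2 T" "w T = w2 T" for T' t2 r2 \<phi>2 w2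
  proof -
    have "interior {0..T'} \<noteq> {}" using that(1) assms(2) by simp
    with geodesic_if_radial_motion[OF assms(1) _ _ radial_motion_paste[OF rm that(2-6)]] that(1) assms(2)
    have "plane_geodesic 4 \<mu> {0..T'} (\<lambda>\<tau>. if \<tau> \<le> T then t \<tau> else t2 \<tau>)
        (\<lambda>\<tau>. if \<tau> \<le> T then r \<tau> else r2 \<tau>) (\<lambda>\<tau>. if \<tau> \<le> T then \<phi> \<tau> else \<phi>2 \<tau>)"
      by (simp add: geodesic_with_def)
    then have "{0..T'} = {0..T}"
      using inext that(1) unfolding future_inextendible_def
      by (elim conjE allE[of _ "{0..T'}"] allE) (fastforce)
    with that(1) assms(2) show False by (simp add: Icc_eq_Icc)
  qed
  show False
  proof (cases "w T = 0")
    case True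
    show False
      by (rule no_cont[OF _ radial_motion_reflect[OF rm]]) (use True assms(2) in auto)
  next
    case False
    \<comment> \<open>The continuation keeps the direction \<open>s\<close> of the velocity, so that
      \<open>s * r\<close> increases from its value \<open>a\<close> at \<open>T\<close>.\<close>
    define s :: real where "s = sgn (w T)"
    have s: "s = 1 \<or> s = -1" "s * w T = \<bar>w T\<bar>" using False by (auto simp: s_def sgn_if)
    have ss: "s * s = 1" using s(1) by auto
    define a where "a = s * r T"
    have sa: "s * a = r T" using ss by (simp add: a_def)
    have Va: "E\<^sup>2 - eff_potential 4 \<mu> L (s * a) = (w T)\<^sup>2" using D(6) by (simp add: sa)
    have r0: "r T > 0" by (rule radial_motion_radius_pos[OF assms(1) rm T])
    have "isCont (\<lambda>x. eff_potential 4 \<mu> L (s * x)) a"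
      using r0 sa
      by (intro isCont_o2[OF isCont_mult[OF continuous_const continuous_ident]
            DERIV_isCont[OF eff_potential_4_deriv]]) simp
    moreover have Va_less: "eff_potential 4 \<mu> L (s * a) < E\<^sup>2"
      using Va False zero_less_power2[of "w T"] by linarith
    ultimately have "\<forall>\<^sub>F x in at a. eff_potential 4 \<mu> L (s * x) < E\<^sup>2"
      by (intro order_tendstoD) (auto simp: isCont_def)
    moreover have "\<forall>\<^sub>F x in at a. sqrt \<mu> < s * x"
      using D(1) sa by (intro order_tendstoD(1)[of _ "s * a"]) (auto intro!: tendsto_eq_intros)
    ultimately have "\<forall>\<^sub>F x in at a. sqrt \<mu> < s * x \<and> eff_potential 4 \<mu> L (s * x) < E\<^sup>2"
      by eventually_elim simp
    then obtain d where d: "d > 0" "\<And>x. x \<noteq> a \<Longrightarrow> dist x a < d \<Longrightarrow>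
        sqrt \<mu> < s * x \<and> eff_potential 4 \<mu> L (s * x) < E\<^sup>2"
      unfolding eventually_at by auto
    \<comment> \<open>Both strict inequalities hold at \<open>a\<close> and persist closer than
      \<open>d\<close> by continuity; half of \<open>d\<close> leaves room for a closed
      interval.\<close>
    have loc: "sqrt \<mu> < s * x \<and> eff_potential 4 \<mu> L (s * x) < E\<^sup>2" if "x \<in> {a..a + d / 2}" for x
    proof (cases "x = a")
      case True
      with D(1) sa Va_less show ?thesis by auto
    next
      case False
      then show ?thesis using d(1) that by (intro d(2)) (auto simp: dist_real_def)
    qed
    have ad: "a < a + d / 2" using d(1) by simp
    obtain T' t2 r2 \<phi>2 w2 where q: "T < T'" "radial_motion \<mu> E L {T..T'} t2 r2 \<phi>2 w2"
      "t2 T = t T" "\<phi>2 T = \<phi> T" "r2 T = s * a" "w2 T = s * sqrt (E\<^sup>2 - eff_potential 4 \<mu> L (s * a))"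
      by (rule radial_motion_by_quadrature[OF assms(1) s(1) ad conjunct1[OF loc] conjunct2[OF loc],
            where ?T0.0 = T and ?t0.0 = "t T" and ?\<phi>0.0 = "\<phi> T"])
    have "w2 T = w T" using s ss unfolding q(6) Va
      by simp
    with no_cont[OF q(1,2)] q(3-5) sa show False by simp
  qed
qed

section \<open>The effective potential in dimension four\<close>

lemma eff_potential_4_eq:
  assumes "r \<noteq> 0"
  shows "eff_potential 4 \<mu> L r = 1 + (L\<^sup>2 - \<mu>) / r\<^sup>2 - L\<^sup>2 * \<mu> / (r\<^sup>2)\<^sup>2"
proof -
  have "(a / x + 1) * (1 - m / x) = 1 + (a - m) / x - a * m / x\<^sup>2" if "x \<noteq> 0" for a m x :: real
    using that by (simp add: field_simps power2_eq_square)
  then show ?thesis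
    using assms by (simp add: eff_potential_def metric_factor_def)
qed

text \<open>The numerator vanishes when
  \<open>(L\<^sup>2 - \<mu>) * r\<^sup>2 = 2 * L\<^sup>2 * \<mu>\<close>. This excludes
  \<open>L = 0\<close>, so the right side is positive, which forces \<open>L\<^sup>2 > \<mu>\<close>
  and determines \<open>r\<^sup>2\<close>.\<close>

lemma radial_force_eq_0_iff:
  assumes "\<mu> > 0" "r > 0"
  shows "radial_force \<mu> L r = 0 \<longleftrightarrow> L\<^sup>2 > \<mu> \<and> r = sqrt (2 * \<mu> / (1 - \<mu> / L\<^sup>2))"
proof
  assume "radial_force \<mu> L r = 0"
  then have eq: "(L\<^sup>2 - \<mu>) * r\<^sup>2 = 2 * L\<^sup>2 * \<mu>" using assms by (simp add: radial_force_def)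
  have "L \<noteq> 0" using eq assms by auto
  then have "2 * L\<^sup>2 * \<mu> > 0" using assms(1) by simp
  then have "(L\<^sup>2 - \<mu>) * r\<^sup>2 > 0" using eq by simp
  then have L: "L\<^sup>2 > \<mu>" using assms(2) by (simp add: zero_less_mult_iff)
  have "r\<^sup>2 = 2 * \<mu> / (1 - \<mu> / L\<^sup>2)"
    using eq L \<open>L \<noteq> 0\<close> by (simp add: field_simps)
  with L assms(2) show "L\<^sup>2 > \<mu> \<and> r = sqrt (2 * \<mu> / (1 - \<mu> / L\<^sup>2))"
    by (metis real_sqrt_unique less_imp_le)
next
  assume r: "L\<^sup>2 > \<mu> \<and> r = sqrt (2 * \<mu> / (1 - \<mu> / L\<^sup>2))"
  then have "L \<noteq> 0" using assms(1) by auto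
  then have "2 * \<mu> / (1 - \<mu> / L\<^sup>2) > 0" using r assms(1) by (simp add: field_simps)
  then have "r\<^sup>2 = 2 * \<mu> / (1 - \<mu> / L\<^sup>2)" using r by simp
  then have "(L\<^sup>2 - \<mu>) * r\<^sup>2 = 2 * L\<^sup>2 * \<mu>"
    using r \<open>L \<noteq> 0\<close> by (simp add: field_simps)
  then show "radial_force \<mu> L r = 0" by (simp add: radial_force_def)
qed

text \<open>The denominator lies strictly between 0 and 1. The gap between sphere and barrier leaves
  room for a particle that has fallen through the barrier.\<close>

lemma critical_radius_gt:
  assumes "\<mu> > 0" "L\<^sup>2 > \<mu>"
  shows "sqrt \<mu> < sqrt (2 * \<mu> / (1 - \<mu> / L\<^sup>2))"
proof -
  define c where "c = 1 - \<mu> / L\<^sup>2"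
  have "L\<^sup>2 > 0" using assms by linarith
  then have "0 < \<mu> / L\<^sup>2" "\<mu> / L\<^sup>2 < 1"
    using assms by (simp_all only: zero_less_divide_iff divide_less_eq_1_pos simp_thms)
  then have c: "0 < c" "c < 1" by (auto simp: c_def)
  then have "\<mu> * c < \<mu> * 2" using assms(1) by simp
  with c have "\<mu> < 2 * \<mu> / c" by (simp add: less_divide_eq)
  then show ?thesis by (simp add: c_def)
qed

lemma radial_force_neg:
  assumes "\<mu> > 0" "L\<^sup>2 < \<mu>" "r > 0"
  shows "radial_force \<mu> L r < 0"
proof -
  have "(L\<^sup>2 - \<mu>) * r\<^sup>2 < 0" using assms by (simp add: mult_neg_pos)
  moreover have "2 * L\<^sup>2 * \<mu> \<ge> 0" using assms by simp
  ultimately have "(L\<^sup>2 - \<mu>) * r\<^sup>2 - 2 * L\<^sup>2 * \<mu> < 0" by linarith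
  then show ?thesis using assms(3) by (simp add: radial_force_def divide_neg_pos)
qed

lemma eff_potential_4_le_critical:
  assumes "\<mu> > 0" "r0 > 0" "r > 0" and crit: "radial_force \<mu> L r0 = 0"
  shows "eff_potential 4 \<mu> L r \<le> eff_potential 4 \<mu> L r0"
    and "r \<noteq> r0 \<Longrightarrow> eff_potential 4 \<mu> L r < eff_potential 4 \<mu> L r0"
proof -
  \<comment> \<open>Criticality of \<open>r0\<close> eliminates \<open>L\<^sup>2 - \<mu>\<close>,
    and the difference of the potentials becomes a multiple of a square in
    \<open>1 / r\<^sup>2\<close>.\<close>
  have LM: "L\<^sup>2 - \<mu> = 2 * (L\<^sup>2 * \<mu>) / r0\<^sup>2"
    using crit assms(2) by (simp add: radial_force_def field_simps)
  have "L\<^sup>2 > \<mu>" using radial_force_eq_0_iff[OF assms(1,2)] crit by blast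
  then have pos: "L\<^sup>2 * \<mu> > 0" using assms(1) by (intro mult_pos_pos) auto
  have eq: "eff_potential 4 \<mu> L r0 - eff_potential 4 \<mu> L r = (L\<^sup>2 * \<mu>) * (1 / r\<^sup>2 - 1 / r0\<^sup>2)\<^sup>2"
  proof -
    have "1 + 2 * a / y * (1 / y) - a / y\<^sup>2 - (1 + 2 * a / y * (1 / x) - a / x\<^sup>2) =
        a * (1 / x - 1 / y)\<^sup>2" if "x \<noteq> 0" "y \<noteq> 0" for a x y :: real
      using that by (simp add: field_simps power2_eq_square)
    from this[of "r\<^sup>2" "r0\<^sup>2" "L\<^sup>2 * \<mu>"] show ?thesis
      using assms(2,3) by (simp add: eff_potential_4_eq LM)
  qed
  then have "eff_potential 4 \<mu> L r0 - eff_potential 4 \<mu> L r \<ge> 0" using pos by simp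
  then show "eff_potential 4 \<mu> L r \<le> eff_potential 4 \<mu> L r0" by simp
  assume "r \<noteq> r0"
  then have "(1 / r\<^sup>2 - 1 / r0\<^sup>2) \<noteq> 0"
    using assms(2,3) by (simp add: power2_eq_iff_nonneg)
  then have "eff_potential 4 \<mu> L r0 - eff_potential 4 \<mu> L r > 0"
    unfolding eq using pos by simp
  then show "eff_potential 4 \<mu> L r < eff_potential 4 \<mu> L r0" by simp
qed

lemma deriv_zero_if_local_extremum:
  assumes "(f has_real_derivative D) (at x)" "local_max_at f x \<or> local_min_at f x"
  shows "D = 0"
proof -
  have "\<exists>d>0. \<forall>y. \<bar>x - y\<bar> < d \<longrightarrow> P y" if "\<forall>\<^sub>F y in nhds x. P y" for P :: "real \<Rightarrow> bool"
    using that by (auto simp: eventually_nhds_metric dist_real_def abs_minus_commute)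
  then show ?thesis
    using assms DERIV_local_max[OF assms(1)] DERIV_local_min[OF assms(1)]
    unfolding local_max_at_def local_min_at_def by blast
qed

lemma local_max_at_critical:
  assumes "\<mu> > 0" "r0 > 0" "radial_force \<mu> L r0 = 0"
  shows "local_max_at (eff_potential 4 \<mu> L) r0"
  unfolding local_max_at_def
proof (rule eventually_mono)
  show "\<forall>\<^sub>F y in nhds r0. y > 0"
    using eventually_nhds_in_open[of "{0<..}" r0] assms(2) by simp
qed (use eff_potential_4_le_critical(1)[OF assms(1,2) _ assms(3)] in auto)

text \<open>A local minimum would be critical, hence a strict maximum over all positive radii, while
  every punctured neighbourhood contains further positive radii.\<close>

lemma not_local_min:
  assumes "\<mu> > 0" "r > 0"
  shows "\<not> local_min_at (eff_potential 4 \<mu> L) r"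
proof
  assume min: "local_min_at (eff_potential 4 \<mu> L) r"
  then have "radial_force \<mu> L r = 0"
    using deriv_zero_if_local_extremum[OF eff_potential_4_deriv, of r \<mu> L] assms(2) by simp
  note less = eff_potential_4_le_critical(2)[OF assms _ this]
  have "\<forall>\<^sub>F y in at r. eff_potential 4 \<mu> L r \<le> eff_potential 4 \<mu> L y"
    using min unfolding local_min_at_def by (auto simp: eventually_at_filter elim: eventually_mono)
  moreover have "\<forall>\<^sub>F y in at r. y > 0 \<and> y \<noteq> r"
    using eventually_at_in_open[of "{0<..}" r] assms(2) by (auto elim: eventually_mono)
  ultimately have "\<forall>\<^sub>F y in at r. False"
    by eventually_elim (use less assms(2) eff_potential_4_le_critical in force)
  then show False by simp
qed

lemma eff_potential_4_tendsto_1: "(eff_potential 4 \<mu> L \<longlongrightarrow> 1) at_top"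
proof -
  have "((\<lambda>r. (L\<^sup>2 / r\<^sup>2 + 1) * (1 - \<mu> / r\<^sup>2)) \<longlongrightarrow> (0 + 1) * (1 - 0)) at_top"
    by (intro tendsto_intros tendsto_divide_0[OF tendsto_const]
        filterlim_at_top_imp_at_infinity filterlim_pow_at_top filterlim_ident) auto
  then show ?thesis by (simp add: eff_potential_def[abs_def] metric_factor_def)
qed

section \<open>Infall for small angular momentum\<close>

text \<open>The potential tends to 1, so beyond some \<open>R\<close> it exceeds
  \<open>E\<^sup>2\<close> and the energy equation cannot hold. The same \<open>R\<close> serves all
  motions with these constants.\<close>

lemma subcritical_motion_bounded:
  assumes "\<mu> > 0" "E\<^sup>2 < 1"
  obtains R where "\<And>I t r \<phi> w \<tau>. radial_motion \<mu> E L I t r \<phi> w \<Longrightarrow> \<tau> \<in> I \<Longrightarrow> r \<tau> \<in> {sqrt \<mu>..R}"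
proof -
  obtain R where R: "\<And>x. x \<ge> R \<Longrightarrow> E\<^sup>2 < eff_potential 4 \<mu> L x"
    using order_tendstoD(1)[OF eff_potential_4_tendsto_1 assms(2), of \<mu> L]
    by (auto simp: eventually_at_top_linorder)
  show ?thesis
  proof (rule that)
    fix I t r \<phi> w \<tau> assume rm: "radial_motion \<mu> E L I t r \<phi> w" "\<tau> \<in> I"
    have "\<not> r \<tau> \<ge> R"
      using R[of "r \<tau>"] radial_motionD(6)[OF rm] zero_le_power2[of "w \<tau>"] by linarith
    with radial_motionD(1)[OF rm] show "r \<tau> \<in> {sqrt \<mu>..R}" by simp
  qed
qed

text \<open>The force is directed inwards everywhere and bounded away from zero on the allowed
  radii, so the motion ends in finite time. Inextendibility excludes a closed end and a limiting
  radius outside the sphere.\<close>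

lemma infall:
  assumes "\<mu> > 0" "L\<^sup>2 < \<mu>" "E\<^sup>2 < 1" and geo: "geodesic_with 4 \<mu> E L I t r \<phi>"
    and inext: "future_inextendible 4 \<mu> I t r \<phi>"
  shows "\<exists>T>0. I = {0..<T} \<and> (r \<longlongrightarrow> sqrt \<mu>) (at_left T) \<and>
    strict_mono_on I (\<lambda>\<tau>. - ptd I r \<tau>) \<and>
    (\<exists>s\<in>I. (\<forall>\<tau>\<in>{s<..<T}. ptd I r \<tau> < 0) \<and> strict_mono_on {s..<T} (\<lambda>\<tau>. \<bar>ptd I r \<tau>\<bar>))"
proof -
  let ?w = "ptd I r"
  have rm: "radial_motion \<mu> E L I t r \<phi> ?w"
    by (rule radial_motion_if_geodesic[OF assms(1) geo])
  note D = radial_motionD[OF rm]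
  have I: "is_interval I" "interior I \<noteq> {}"
    using geo by (auto simp: geodesic_with_def plane_geodesic_def)
  have I0: "0 \<in> I" "I \<subseteq> {0..}"
    using inext by (auto simp: future_inextendible_def)
  have "sqrt \<mu> > 0" using assms(1) by simp
  obtain R where R: "\<And>\<tau>. \<tau> \<in> I \<Longrightarrow> r \<tau> \<in> {sqrt \<mu>..R}"
    using subcritical_motion_bounded[OF assms(1,3), of L] rm by metis
  have sub: "{sqrt \<mu>..R} \<subseteq> {0<..}"
    using less_le_trans[OF \<open>sqrt \<mu> > 0\<close>] by auto
  have "{sqrt \<mu>..R} \<noteq> {}" using R[OF I0(1)] by auto
  then obtain x0 where x0: "x0 \<in> {sqrt \<mu>..R}"
      "\<And>x. x \<in> {sqrt \<mu>..R} \<Longrightarrow> radial_force \<mu> L x \<le> radial_force \<mu> L x0"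
    using continuous_attains_sup[OF compact_Icc _ continuous_on_radial_force[OF sub]] by metis
  \<comment> \<open>The least inward force on the allowed radii; it bounds the duration by
    \<open>2 * \<bar>E\<bar> / c\<close>.\<close>
  define c where "c = - radial_force \<mu> L x0"
  have "c > 0"
    using radial_force_neg[OF assms(1,2)] x0(1) sub by (auto simp: c_def)
  have "\<tau> \<le> 2 * \<bar>E\<bar> / c" if "\<tau> \<in> I" for \<tau>
  proof -
    have "c * (\<tau> - 0) \<le> 2 * \<bar>E\<bar>"
      by (rule radial_motion_duration_bound[OF assms(1) rm I(1) I0(1) that, where s = "-1"])
         (use x0(2) R that I0(2) in \<open>auto simp: c_def\<close>)
    then show ?thesis using \<open>c > 0\<close> by (simp add: field_simps)
  qed
  then have bdd: "bdd_above I" by (auto simp: bdd_above_def)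
  define T where "T = Sup I"
  have le_T: "\<tau> \<le> T" if "\<tau> \<in> I" for \<tau>
    using that bdd by (simp add: T_def cSup_upper)
  have less_T: "\<tau> \<in> I" if \<tau>: "0 \<le> \<tau>" "\<tau> < T" for \<tau>
  proof -
    obtain x where "x \<in> I" "\<tau> < x"
      using \<tau>(2) less_cSup_iff[of I \<tau>] bdd I0(1) by (auto simp: T_def)
    then show ?thesis
      using mem_is_interval_1_I[OF I(1) I0(1), of x \<tau>] \<tau>(1) by simp
  qed
  have "T \<noteq> 0"
  proof
    assume "T = 0"
    then have "I \<subseteq> {0}" using le_T I0(2) by force
    with I(2) show False
      by (metis interior_mono interior_singleton subset_empty)
  qed
  then have T: "T > 0" using le_T[OF I0(1)] by simp
  have mem_I: "\<tau> \<in> I \<longleftrightarrow> 0 \<le> \<tau> \<and> (\<tau> < T \<or> \<tau> = T \<and> T \<in> I)" for \<tau>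
    using le_T[of \<tau>] less_T[of \<tau>] subsetD[OF I0(2), of \<tau>] T by (cases "\<tau> = T") auto
  have IT: "I = {0..<T}"
  proof (cases "T \<in> I")
    case True
    have "x \<in> I \<longleftrightarrow> x \<in> {0..T}" for x using mem_I[of x] True by auto
    then have "I = {0..T}" by blast
    then show ?thesis
      using not_inextendible_at_closed_end[OF assms(1) T] geo inext by blast
  next
    case False
    have "x \<in> I \<longleftrightarrow> x \<in> {0..<T}" for x using mem_I[of x] False by auto
    then show ?thesis by blast
  qed
  obtain r' w' where ext: "\<And>\<tau>. \<tau> \<in> {0..<T} \<Longrightarrow> r' \<tau> = r \<tau>" "\<And>\<tau>. \<tau> \<in> {0..<T} \<Longrightarrow> w' \<tau> = ?w \<tau>"
    "\<And>\<tau>. \<tau> \<in> {0..T} \<Longrightarrow> (r' has_real_derivative w' \<tau>) (at \<tau> within {0..T})"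
    "\<And>\<tau>. \<tau> \<in> {0..T} \<Longrightarrow> (w' has_real_derivative radial_force \<mu> L (r' \<tau>)) (at \<tau> within {0..T})"
    "\<And>\<tau>. \<tau> \<in> {0..T} \<Longrightarrow> (w' \<tau>)\<^sup>2 + eff_potential 4 \<mu> L (r' \<tau>) = E\<^sup>2"
    "sqrt \<mu> \<le> r' T" "(r \<longlongrightarrow> r' T) (at_left T)"
    using radial_motion_extends_to_right_end[OF assms(1) T rm[unfolded IT]] unfolding IT by blast
  \<comment> \<open>For a larger limit the rates of \<open>t\<close> and \<open>\<phi>\<close> are
    continuous up to \<open>T\<close>, so all coordinates would extend to
    \<open>{0..T}\<close>.\<close>
  have r'T: "r' T = sqrt \<mu>"
  proof (rule ccontr)
    assume "r' T \<noteq> sqrt \<mu>"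
    then have "sqrt \<mu> < r' T" using ext(6) by simp
    then have r'_gt: "sqrt \<mu> < r' \<tau>" if "\<tau> \<in> {0..T}" for \<tau>
      using that ext(1)[of \<tau>] D(1)[of \<tau>] IT by (cases "\<tau> = T") auto
    have r'_pos: "r' \<tau> > 0" if "\<tau> \<in> {0..T}" for \<tau>
      using less_trans[OF \<open>sqrt \<mu> > 0\<close> r'_gt[OF that]] .
    have cr: "continuous_on {0..T} r'" by (rule DERIV_continuous_on[OF ext(3)])
    have ct: "continuous_on {0..T} (\<lambda>\<tau>. E / metric_factor 4 \<mu> (r' \<tau>))"
      using metric_factor_4_pos[OF assms(1) r'_gt] r'_pos
      by (intro continuous_intros continuous_on_compose2[OF
          continuous_on_metric_factor_4[OF order_refl] cr]) (auto simp: less_imp_neq[symmetric])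
    have dt: "(t has_real_derivative E / metric_factor 4 \<mu> (r' \<tau>)) (at \<tau> within {0..<T})"
      if "\<tau> \<in> {0..<T}" for \<tau>
      using D(2)[of \<tau>] that ext(1)[OF that] unfolding IT by simp
    obtain t' where t': "\<And>\<tau>. \<tau> \<in> {0..<T} \<Longrightarrow> t' \<tau> = t \<tau>" "\<And>\<tau>. \<tau> \<in> {0..T} \<Longrightarrow>
        (t' has_real_derivative E / metric_factor 4 \<mu> (r' \<tau>)) (at \<tau> within {0..T})"
      by (rule primitive_extends_to_right_end[OF T dt ct]) (assumption, rule that)
    have c\<phi>: "continuous_on {0..T} (\<lambda>\<tau>. L / (r' \<tau>)\<^sup>2)"
      using r'_pos by (intro continuous_intros cr) force
    have d\<phi>: "(\<phi> has_real_derivative L / (r' \<tau>)\<^sup>2) (at \<tau> within {0..<T})"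
      if "\<tau> \<in> {0..<T}" for \<tau>
      using D(3)[of \<tau>] that ext(1)[OF that] unfolding IT by simp
    obtain \<phi>' where \<phi>': "\<And>\<tau>. \<tau> \<in> {0..<T} \<Longrightarrow> \<phi>' \<tau> = \<phi> \<tau>" "\<And>\<tau>. \<tau> \<in> {0..T} \<Longrightarrow>
        (\<phi>' has_real_derivative L / (r' \<tau>)\<^sup>2) (at \<tau> within {0..T})"
      by (rule primitive_extends_to_right_end[OF T d\<phi> c\<phi>]) (assumption, rule that)
    have "radial_motion \<mu> E L {0..T} t' r' \<phi>' w'"
      unfolding radial_motion_def using r'_gt t'(2) \<phi>'(2) ext(3-5) by blast
    then have "plane_geodesic 4 \<mu> {0..T} t' r' \<phi>'"
      using geodesic_if_radial_motion[OF assms(1), of "{0..T}"] T by (simp add: geodesic_with_def)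
    then have "{0..T} = {0..<T}"
      using inext t'(1) \<phi>'(1) ext(1) unfolding IT future_inextendible_def
      by (elim conjE allE[of _ "{0..T}"] allE) fastforce
    with T show False by auto
  qed
  have dec: "?w y < ?w x" if xy: "x \<in> I" "y \<in> I" "x < y" for x y
  proof -
    obtain z where z: "z \<in> I" "?w y - ?w x = (y - x) * radial_force \<mu> L (r z)"
      using mvt_within_interval[OF I(1) xy D(5)] by blast
    have "radial_force \<mu> L (r z) < 0"
      by (rule radial_force_neg[OF assms(1,2) radial_motion_radius_pos[OF assms(1) rm z(1)]])
    with xy(3) have "(y - x) * radial_force \<mu> L (r z) < 0" by (simp add: mult_pos_neg)
    with z(2) show ?thesis by simp
  qed
  \<comment> \<open>With positive velocity throughout, the radius would increase from above
    \<open>sqrt \<mu>\<close> and could not tend to it.\<close>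
  have "\<exists>s\<in>I. ?w s \<le> 0"
  proof (rule ccontr)
    assume "\<not> (\<exists>s\<in>I. ?w s \<le> 0)"
    then have pos: "w' \<tau> > 0" if "\<tau> \<in> {0..<T}" for \<tau>
      using that ext(2)[OF that] IT by force
    obtain z where "0 < z" "z < T" "r' T - r' 0 = (T - 0) * w' z"
      using mvt_within_interval[of "{0..T}" 0 T r' w'] ext(3) T by (auto simp: is_interval_1)
    moreover have "(T - 0) * w' z > 0" using pos[of z] T calculation by simp
    ultimately have "r' T > r' 0" by simp
    moreover have "r' 0 > sqrt \<mu>" using ext(1)[of 0] D(1)[OF I0(1)] T by simp
    ultimately show False using r'T by simp
  qed
  then obtain s where s: "s \<in> I" "?w s \<le> 0" by blast
  have neg: "?w \<tau> < 0" if "\<tau> \<in> {s<..<T}" for \<tau>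
    using dec[OF s(1), of \<tau>] s that IT by auto
  have "strict_mono_on {s..<T} (\<lambda>\<tau>. \<bar>?w \<tau>\<bar>)"
  proof (rule strict_mono_onI)
    fix x y assume xy: "x \<in> {s..<T}" "y \<in> {s..<T}" "x < y"
    have "?w x \<le> 0" using neg[of x] s(2) xy(1) by (cases "x = s") auto
    moreover have "?w y < ?w x" using dec[of x y] xy s(1) IT by auto
    ultimately show "\<bar>?w x\<bar> < \<bar>?w y\<bar>" by simp
  qed
  moreover have "strict_mono_on I (\<lambda>\<tau>. - ?w \<tau>)"
    using dec by (auto intro: strict_mono_onI)
  ultimately show ?thesis
    using T IT ext(7) r'T neg s(1) by (intro exI[of _ T] conjI bexI[of _ s] ballI) auto
qed

section \<open>Instability of bounded orbits\<close>

text \<open>The motion stays in the compact set of radii up to \<open>R\<close> at which the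
  potential is at most \<open>E\<^sup>2\<close>; lasting forever, it needs a critical point in this
  set.\<close>

lemma eternal_bounded_motion_above_barrier:
  assumes "\<mu> > 0" and rm: "radial_motion \<mu> E L {a..} t r \<phi> w" and R: "\<And>\<tau>. \<tau> \<ge> a \<Longrightarrow> r \<tau> \<le> R"
  obtains r0 where "sqrt \<mu> \<le> r0" "r0 \<le> R" "radial_force \<mu> L r0 = 0" "eff_potential 4 \<mu> L r0 \<le> E\<^sup>2"
proof -
  have "sqrt \<mu> > 0" using assms(1) by simp
  define K where "K = {x \<in> {sqrt \<mu>..R}. eff_potential 4 \<mu> L x \<le> E\<^sup>2}"
  have sub: "{sqrt \<mu>..R} \<subseteq> {0<..}"
    using less_le_trans[OF \<open>sqrt \<mu> > 0\<close>] by auto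
  have "compact K"
    unfolding K_def
    by (intro compact_le_set continuous_on_eff_potential_4[OF sub] continuous_on_const)
  moreover have "K \<subseteq> {0<..}" using sub by (auto simp: K_def)
  moreover have "r \<tau> \<in> K" if "\<tau> \<ge> a" for \<tau>
  proof -
    have "\<tau> \<in> {a..}" using that by simp
    note D = radial_motionD[OF rm this]
    have "eff_potential 4 \<mu> L (r \<tau>) \<le> E\<^sup>2"
      using D(6) zero_le_power2[of "w \<tau>"] by linarith
    with D(1) R[OF that] show ?thesis by (simp add: K_def)
  qed
  ultimately have "\<exists>x\<in>K. radial_force \<mu> L x = 0"
    using no_eternal_motion_without_critical_point[OF assms(1) rm] by blast
  with that show ?thesis by (auto simp: K_def)
qed

text \<open>An orbit that starts inwards has to stay outside the barrier: inside it, the velocity could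
  not vanish, so that the motion would be inwards at all later times, away from the critical point.\<close>

lemma ingoing_eternal_motion_outside_barrier:
  assumes "\<mu> > 0" and rm: "radial_motion \<mu> E L {0..} t r \<phi> w" and "w 0 < 0"
    and r0: "r0 > 0" "radial_force \<mu> L r0 = 0" "eff_potential 4 \<mu> L r0 \<le> E\<^sup>2" and "\<tau> \<ge> 0"
  shows "r0 \<le> r \<tau>"
proof (rule ccontr)
  assume "\<not> r0 \<le> r \<tau>"
  then have inside: "r \<tau> < r0" by simp
  note D = radial_motionD[OF rm]
  have cw: "continuous_on {0..} w" by (rule radial_motion_continuous(2)[OF rm])
  \<comment> \<open>Strictly inside the barrier the potential is below its maximum, hence below
    \<open>E\<^sup>2\<close>, which excludes turning points.\<close>
  have w0: "w x \<noteq> 0" if "x \<ge> 0" "r x < r0" for x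
    using eff_potential_4_le_critical(2)[OF assms(1) r0(1) radial_motion_radius_pos[OF assms(1) rm] r0(2), of x]
      D(6)[of x] r0(3) that by auto
  have neg_\<tau>: "w \<tau> < 0"
  proof (rule ccontr)
    assume "\<not> w \<tau> < 0"
    have "\<exists>x. x \<in> {0..\<tau>} \<and> w x = 0 \<and> (\<forall>y\<in>{x..\<tau>}. w y \<ge> 0)"
    proof -
      \<comment> \<open>The last time up to \<open>\<tau>\<close> without outward velocity exists
        because the motion starts inwards; it must be a turning point.\<close>
      let ?Z = "{x \<in> {0..\<tau>}. w x \<le> 0}"
      have "compact ?Z"
        by (intro compact_le_set continuous_on_subset[OF cw] continuous_on_const) auto
      moreover have "0 \<in> ?Z" using assms(3,7) by simp
      ultimately obtain x where x: "x \<in> ?Z" "\<And>y. y \<in> ?Z \<Longrightarrow> y \<le> x"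
        using compact_attains_sup[of ?Z] by blast
      have pos: "w y > 0" if "y \<in> {x<..\<tau>}" for y
        using x(2)[of y] x(1) that by force
      have "w x = 0"
      proof (rule ccontr)
        assume "w x \<noteq> 0"
        then have "w x < 0" using x(1) by auto
        moreover have "x \<le> \<tau>" "continuous_on {x..\<tau>} w"
          using x(1) by (auto intro: continuous_on_subset[OF cw])
        ultimately obtain y where "y \<in> {x..\<tau>}" "w y = 0"
          using IVT'[of w x 0 \<tau>] \<open>\<not> w \<tau> < 0\<close> by auto
        with pos[of y] \<open>w x < 0\<close> show False by (cases "y = x") auto
      qed
      with pos x(1) show ?thesis by (intro exI[of _ x]) (force simp: le_less)
    qed
    then obtain x where x: "x \<in> {0..\<tau>}" "w x = 0" "\<And>y. y \<in> {x..\<tau>} \<Longrightarrow> w y \<ge> 0" by blast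
    \<comment> \<open>After the turning point the velocity is not inwards, so the turning point
      itself lies inside the barrier, contradicting \<open>w0\<close>.\<close>
    have "r x \<le> r \<tau>"
    proof (cases "x < \<tau>")
      case True
      obtain z where "x < z" "z < \<tau>" "r \<tau> - r x = (\<tau> - x) * w z"
        using mvt_within_interval[of "{0..}" x \<tau> r w, OF _ _ _ True D(4)] x(1)
        by (auto simp: is_interval_1)
      with x(3)[of z] True show ?thesis by (smt (verit) atLeastAtMost_iff mult_nonneg_nonneg)
    qed (use x(1) in auto)
    with w0[of x] x(1,2) inside show False by simp
  qed
  have later: "w y < 0 \<and> r y \<le> r \<tau>" if "y \<ge> \<tau>" for y
  proof -
    have "w y < 0" if "y \<ge> \<tau>" for y
    proof (rule ccontr)
      assume "\<not> w y < 0"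
      \<comment> \<open>Up to the first time after \<open>\<tau>\<close> without inward velocity the
        radius decreases, so that time is still inside the barrier and the velocity would vanish
        there.\<close>
      let ?Z = "{x \<in> {\<tau>..y}. 0 \<le> w x}"
      have "compact ?Z"
        using assms(7)
        by (intro compact_le_set continuous_on_subset[OF cw] continuous_on_const) auto
      moreover have "y \<in> ?Z" using \<open>\<not> w y < 0\<close> that by simp
      ultimately obtain x where x: "x \<in> ?Z" "\<And>y. y \<in> ?Z \<Longrightarrow> x \<le> y"
        using compact_attains_inf[of ?Z] by blast
      have neg: "w z < 0" if "z \<in> {\<tau>..<x}" for z
        using x(2)[of z] x(1) that by force
      have "\<tau> < x" using x(1) neg_\<tau> by (cases "x = \<tau>") auto
      then obtain z where z: "\<tau> < z" "z < x" "r x - r \<tau> = (x - \<tau>) * w z"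
        using mvt_within_interval[of "{0..}" \<tau> x r w, OF _ _ _ _ D(4)] assms(7)
        by (auto simp: is_interval_1)
      have "(x - \<tau>) * w z < 0" using neg[of z] z(1,2) \<open>\<tau> < x\<close> by (simp add: mult_pos_neg)
      then have "r x < r0" using z(3) inside by simp
      then have "w x \<noteq> 0" using w0[of x] x(1) assms(7) by auto
      then have "w x > 0" using x(1) by auto
      then obtain v where "v \<in> {\<tau>..x}" "w v = 0"
        using IVT'[of w \<tau> 0 x] neg_\<tau> \<open>\<tau> < x\<close> continuous_on_subset[OF cw, of "{\<tau>..x}"] assms(7)
        by auto
      with neg[of v] \<open>w x > 0\<close> show False by (cases "v = x") auto
    qed
    note neg = this
    have "r y \<le> r \<tau>"
    proof (cases "\<tau> < y")
      case True
      then obtain z where "\<tau> < z" "z < y" "r y - r \<tau> = (y - \<tau>) * w z"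
        using mvt_within_interval[of "{0..}" \<tau> y r w, OF _ _ _ _ D(4)] assms(7)
        by (auto simp: is_interval_1)
      moreover have "(y - \<tau>) * w z < 0" using neg[of z] calculation True by (simp add: mult_pos_neg)
      ultimately show ?thesis by simp
    qed (use that in auto)
    with neg[OF that] show ?thesis by simp
  qed
  \<comment> \<open>Restarted at \<open>\<tau>\<close> the motion is bounded by
    \<open>r \<tau>\<close>, so there is a critical radius below \<open>r0\<close>, against
    uniqueness.\<close>
  have "radial_motion \<mu> E L {\<tau>..} t r \<phi> w"
    by (rule radial_motion_subset[OF rm]) (use assms(7) in auto)
  then obtain x0 where x0: "sqrt \<mu> \<le> x0" "x0 \<le> r \<tau>" "radial_force \<mu> L x0 = 0"
    using eternal_bounded_motion_above_barrier[OF assms(1), of E L \<tau> t r \<phi> w "r \<tau>"] later by metis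
  have "x0 > 0" using x0(1) assms(1) by (smt (verit) real_sqrt_gt_zero)
  then have "x0 = r0"
    using radial_force_eq_0_iff[OF assms(1)] x0(3) r0(1,2) by metis
  with x0(2) inside show False by simp
qed

section \<open>Perturbed orbits\<close>

lemma stable_orbitD:
  assumes "stable_orbit 4 \<mu> L r" "\<epsilon> > 0"
  obtains \<delta> where "\<delta> > 0" "\<And>T E' t' r' \<phi>'. \<lbrakk>T > 0; geodesic_with 4 \<mu> E' L {0..<T} t' r' \<phi>';
     \<bar>r' 0 - r 0\<bar> < \<delta>; \<bar>ptd {0..<T} r' 0 - ptd {0..} r 0\<bar> < \<delta>\<rbrakk> \<Longrightarrow>
     \<forall>\<tau>\<in>{0..<T}. \<bar>r' \<tau> - r \<tau>\<bar> < \<epsilon>"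
proof -
  obtain \<delta> where "\<delta> > 0" and \<delta>: "\<forall>T>0. \<forall>E' t' r' \<phi>'.
        geodesic_with 4 \<mu> E' L {0..<T} t' r' \<phi>' \<and>
        \<bar>r' 0 - r 0\<bar> < \<delta> \<and> \<bar>ptd {0..<T} r' 0 - ptd {0..} r 0\<bar> < \<delta> \<longrightarrow>
        (\<forall>\<tau>\<in>{0..<T}. \<bar>r' \<tau> - r \<tau>\<bar> < \<epsilon>)"
    using assms(1)[unfolded stable_orbit_def, THEN spec, THEN mp, OF assms(2)]
    by (elim exE conjE) (rule that)
  show ?thesis
    by (rule that[OF \<open>\<delta> > 0\<close>]) (use \<delta> in blast)
qed

text \<open>Slightly more energy than that of the orbit suffices to cross the barrier, since the orbit
  has at least the energy of the barrier already; the faster particle thus reaches any radius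
  \<open>s * b\<close> in the direction \<open>s\<close> of its initial velocity.\<close>

lemma perturbed_orbit_reaches:
  assumes "\<mu> > 0" and rm: "radial_motion \<mu> E L {0..} t r \<phi> w" and stable: "stable_orbit 4 \<mu> L r"
    and r0: "r0 > 0" "radial_force \<mu> L r0 = 0" "eff_potential 4 \<mu> L r0 \<le> E\<^sup>2"
    and s: "s = 1 \<or> s = -1" "s * w 0 = \<bar>w 0\<bar>" and b: "s * r 0 < b" "sqrt \<mu> < s * b" and "\<epsilon> > 0"
    and m: "s * r 0 < m" "m < b"
  obtains \<tau> where "\<tau> \<ge> 0" "\<bar>s * m - r \<tau>\<bar> < \<epsilon>"
proof -
  have ss: "s * s = 1" using s(1) by auto
  have zero: "(0::real) \<in> {0..}" by simp
  note D = radial_motionD[OF rm zero]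
  have "sqrt \<mu> > 0" using assms(1) by simp
  obtain \<delta> where \<delta>: "\<delta> > 0" "\<And>T E' t' r' \<phi>'. \<lbrakk>T > 0; geodesic_with 4 \<mu> E' L {0..<T} t' r' \<phi>';
     \<bar>r' 0 - r 0\<bar> < \<delta>; \<bar>ptd {0..<T} r' 0 - ptd {0..} r 0\<bar> < \<delta>\<rbrakk> \<Longrightarrow>
     \<forall>\<tau>\<in>{0..<T}. \<bar>r' \<tau> - r \<tau>\<bar> < \<epsilon>"
    using stable_orbitD[OF stable \<open>\<epsilon> > 0\<close>] by blast
  define \<eta> where "\<eta> = \<delta> / 2"
  have \<eta>: "\<eta> > 0" "\<eta> < \<delta>" using \<delta>(1) by (auto simp: \<eta>_def)
  \<comment> \<open>From the same radius this energy gives the initial speed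
    \<open>sqrt ((w 0)\<^sup>2 + \<eta>\<^sup>2)\<close>, which differs from
    \<open>\<bar>w 0\<bar>\<close> by at most \<open>\<eta> < \<delta>\<close>.\<close>
  define E' where "E' = sqrt (E\<^sup>2 + \<eta>\<^sup>2)"
  have E': "E'\<^sup>2 = E\<^sup>2 + \<eta>\<^sup>2" by (simp add: E'_def)
  have out: "sqrt \<mu> < s * x" if "x \<in> {s * r 0..b}" for x
    using s(1) that D(1) b(2) by auto
  have V: "eff_potential 4 \<mu> L (s * x) < E'\<^sup>2" if "x \<in> {s * r 0..b}" for x
  proof -
    have "eff_potential 4 \<mu> L (s * x) \<le> E\<^sup>2"
      using eff_potential_4_le_critical(1)[OF assms(1) r0(1) less_trans[OF \<open>sqrt \<mu> > 0\<close> out[OF that]] r0(2)]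
        r0(3) by simp
    moreover have "\<eta>\<^sup>2 > 0" using \<eta>(1) by simp
    ultimately show ?thesis unfolding E' by linarith
  qed
  obtain T t' r' \<phi>' w' where q: "0 < T" "radial_motion \<mu> E' L {0..T} t' r' \<phi>' w'"
    "r' 0 = s * (s * r 0)" "r' T = s * b"
    "w' 0 = s * sqrt (E'\<^sup>2 - eff_potential 4 \<mu> L (s * (s * r 0)))"
    by (rule radial_motion_by_quadrature[OF assms(1) s(1) b(1) out V, where ?T0.0 = 0])
  have sr: "s * (s * r 0) = r 0" by (simp add: mult.assoc[symmetric] ss)
  then have r'0: "r' 0 = r 0" using q(3) by simp
  have w'0: "w' 0 = s * sqrt ((w 0)\<^sup>2 + \<eta>\<^sup>2)"
  proof -
    have "E'\<^sup>2 - eff_potential 4 \<mu> L (r 0) = (w 0)\<^sup>2 + \<eta>\<^sup>2" using D(6) E' by linarith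
    then show ?thesis by (simp add: q(5) sr)
  qed
  have rmT: "radial_motion \<mu> E' L {0..<T} t' r' \<phi>' w'"
    by (rule radial_motion_subset[OF q(2)]) auto
  have iT: "is_interval {0..<T}" "interior {0..<T} \<noteq> {}" "0 \<in> {0..<T}"
    using q(1) by (auto simp: is_interval_1)
  have "ptd {0..<T} r' 0 = w' 0"
    by (rule ptd_eq[OF iT radial_motionD(4)[OF rmT iT(3)]])
  moreover have "ptd {0..} r 0 = w 0"
    by (rule ptd_eq[OF _ _ zero D(4)]) (auto simp: is_interval_1 interior_real_atLeast)
  moreover have "\<bar>w' 0 - w 0\<bar> < \<delta>"
  proof -
    have "w 0 = s * \<bar>w 0\<bar>" using s ss by (metis mult.assoc mult_1)
    then have "w' 0 - w 0 = s * (sqrt ((w 0)\<^sup>2 + \<eta>\<^sup>2) - \<bar>w 0\<bar>)"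
      by (simp add: w'0 algebra_simps)
    then have "\<bar>w' 0 - w 0\<bar> = \<bar>sqrt ((w 0)\<^sup>2 + \<eta>\<^sup>2) - \<bar>w 0\<bar>\<bar>"
      using s(1) by auto
    moreover have "sqrt ((w 0)\<^sup>2 + \<eta>\<^sup>2) \<le> \<bar>w 0\<bar> + \<bar>\<eta>\<bar>" by (rule sqrt_sum_squares_le_sum_abs)
    moreover have "\<bar>w 0\<bar> \<le> sqrt ((w 0)\<^sup>2 + \<eta>\<^sup>2)" by (rule real_le_rsqrt) simp
    ultimately show ?thesis using \<eta> by simp
  qed
  moreover have "geodesic_with 4 \<mu> E' L {0..<T} t' r' \<phi>'"
    by (rule geodesic_if_radial_motion[OF assms(1) iT(1,2) rmT])
  ultimately have close: "\<forall>\<tau>\<in>{0..<T}. \<bar>r' \<tau> - r \<tau>\<bar> < \<epsilon>"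
    using \<delta>(1) r'0 by (intro \<delta>(2)[OF q(1)]) auto
  have "continuous_on {0..T} (\<lambda>\<tau>. s * r' \<tau>)"
    by (intro continuous_intros radial_motion_continuous(1)[OF q(2)])
  moreover have "s * r' 0 \<le> m" "m \<le> s * r' T"
    using m r'0 q(4) ss by (auto simp: mult.assoc[symmetric])
  ultimately obtain \<tau> where \<tau>: "\<tau> \<in> {0..T}" "s * r' \<tau> = m"
    using IVT'[of "\<lambda>\<tau>. s * r' \<tau>" 0 m T] q(1) by auto
  \<comment> \<open>The intermediate target \<open>m < b\<close> is reached strictly before
    \<open>T\<close>, where stability controls the radius.\<close>
  have "\<tau> \<noteq> T" using \<tau>(2) q(4) m(2) ss by (auto simp: mult.assoc[symmetric])
  moreover have "r' \<tau> = s * m" using \<tau>(2) ss by (metis mult.assoc mult_1)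
  ultimately show ?thesis using that[of \<tau>] bspec[OF close, of \<tau>] \<tau>(1) by simp
qed

lemma bounded_orbit_not_stable:
  assumes "\<mu> > 0" "bounded_orbit 4 \<mu> E L t r \<phi>"
  shows "\<not> stable_orbit 4 \<mu> L r"
proof
  assume stable: "stable_orbit 4 \<mu> L r"
  define w where "w = ptd {0..} r"
  have rm: "radial_motion \<mu> E L {0..} t r \<phi> w"
    using radial_motion_if_geodesic assms unfolding bounded_orbit_def w_def by blast
  obtain R where R: "\<And>\<tau>. \<tau> \<ge> 0 \<Longrightarrow> r \<tau> \<le> R"
    using assms(2) unfolding bounded_orbit_def bounded_iff by (force simp: abs_le_iff)
  have "sqrt \<mu> > 0" using assms(1) by simp
  obtain r0 where r0: "sqrt \<mu> \<le> r0" "radial_force \<mu> L r0 = 0" "eff_potential 4 \<mu> L r0 \<le> E\<^sup>2"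
    using eternal_bounded_motion_above_barrier[OF assms(1) rm R] by metis
  have r0_pos: "r0 > 0" using less_le_trans[OF \<open>sqrt \<mu> > 0\<close> r0(1)] .
  note reach = perturbed_orbit_reaches[OF assms(1) rm stable r0_pos r0(2,3)]
  show False
  proof (cases "w 0 < 0")
    case False
    have "sqrt \<mu> < R" using radial_motionD(1)[OF rm, of 0] R[of 0] by simp
    \<comment> \<open>The target exceeds the bound \<open>R\<close> by the tolerance 1; the
      quadrature runs on to \<open>R + 2\<close>.\<close>
    moreover obtain \<tau> where "\<tau> \<ge> 0" "\<bar>1 * (R + 1) - r \<tau>\<bar> < 1"
      by (rule reach[of 1 "R + 2" 1 "R + 1"]) (use False R[of 0] calculation in auto)
    ultimately show False using R[of \<tau>] by simp
  next
    case True
    have r0_less: "sqrt \<mu> < r0"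
      using radial_force_eq_0_iff[OF assms(1) r0_pos] r0(2) critical_radius_gt[OF assms(1)] by metis
    have outside: "r0 \<le> r \<tau>" if "\<tau> \<ge> 0" for \<tau>
      by (rule ingoing_eternal_motion_outside_barrier[OF assms(1) rm True r0_pos r0(2,3) that])
    \<comment> \<open>With a third of the gap, the perturbed particle can go down to
      \<open>r0 - 2 * d\<close>, still outside the sphere, and passes \<open>r0 - d\<close>;
      tolerance \<open>d\<close> then puts the orbit inside \<open>r0\<close>.\<close>
    define d where "d = (r0 - sqrt \<mu>) / 3"
    have d: "d > 0" "sqrt \<mu> = r0 - 3 * d" using r0_less by (simp_all add: d_def field_simps)
    obtain \<tau> where "\<tau> \<ge> 0" "\<bar>- 1 * - (r0 - d) - r \<tau>\<bar> < d"
      by (rule reach[of "-1" "- (r0 - 2 * d)" d "- (r0 - d)"])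
         (use True d outside[of 0] in auto)
    with outside[of \<tau>] show False by simp
  qed
qed

text \<open>A particle that starts outwards slows down at first, so the speed increases only from
  some time \<open>s\<close> on, whereas the inward velocity increases throughout.\<close>

theorem mainTheorem4:
  fixes \<mu> L :: real and V :: "real \<Rightarrow> real"
  assumes "\<mu> > 0"
    and "V = (\<lambda>r. (L\<^sup>2 / r\<^sup>2 + 1) * (1 - \<mu> / r\<^sup>2))"
  shows
    "(L\<^sup>2 > \<mu> \<longrightarrow>
        (\<forall>r>0. deriv V r = 0 \<longleftrightarrow> r = sqrt (2 * \<mu> / (1 - \<mu> / L\<^sup>2))) \<and>
        local_max_at V (sqrt (2 * \<mu> / (1 - \<mu> / L\<^sup>2)))) \<and>
     (L\<^sup>2 = \<mu> \<longrightarrow>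
        (\<forall>r>0. deriv V r \<noteq> 0) \<and> (V \<longlongrightarrow> 1) at_top \<and> (\<forall>\<^sub>F r in at_top. V r \<le> 1)) \<and>
     (L\<^sup>2 < \<mu> \<longrightarrow>
        (\<forall>r>0. deriv V r \<noteq> 0 \<and> \<not> local_max_at V r \<and> \<not> local_min_at V r) \<and>
        (\<forall>E I t r \<phi>.
           geodesic_with 4 \<mu> E L I t r \<phi> \<and> future_inextendible 4 \<mu> I t r \<phi> \<and> E\<^sup>2 < 1 \<longrightarrow>
           (\<exists>T>0. I = {0..<T} \<and> (r \<longlongrightarrow> sqrt \<mu>) (at_left T) \<and>
              strict_mono_on I (\<lambda>\<tau>. - ptd I r \<tau>) \<and>
              (\<exists>s\<in>I. (\<forall>\<tau>\<in>{s<..<T}. ptd I r \<tau> < 0) \<and>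
                 strict_mono_on {s..<T} (\<lambda>\<tau>. \<bar>ptd I r \<tau>\<bar>))))) \<and>
     (\<forall>r>0. \<not> local_min_at V r) \<and>
     \<not> (\<exists>E t r \<phi>. bounded_orbit 4 \<mu> E L t r \<phi> \<and> stable_orbit 4 \<mu> L r)"
proof -
  have V: "V = eff_potential 4 \<mu> L"
    by (simp add: assms(2) fun_eq_iff eff_potential_def metric_factor_def)
  have dV: "(V has_real_derivative - 2 * radial_force \<mu> L r) (at r)" if "r > 0" for r
    unfolding V using that by (intro eff_potential_4_deriv) simp
  then have deriv_0: "deriv V r = 0 \<longleftrightarrow> L\<^sup>2 > \<mu> \<and> r = sqrt (2 * \<mu> / (1 - \<mu> / L\<^sup>2))" if "r > 0" for r
    using that DERIV_imp_deriv[OF dV[OF that]] radial_force_eq_0_iff[OF assms(1) that, of L] by simp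
  have max: "local_max_at V (sqrt (2 * \<mu> / (1 - \<mu> / L\<^sup>2)))" if "L\<^sup>2 > \<mu>"
  proof -
    have "sqrt \<mu> > 0" using assms(1) by simp
    then have "sqrt (2 * \<mu> / (1 - \<mu> / L\<^sup>2)) > 0"
      using critical_radius_gt[OF assms(1) that] by (rule less_trans)
    then show ?thesis
      unfolding V using radial_force_eq_0_iff[OF assms(1)] that
      by (intro local_max_at_critical[OF assms(1)]) blast+
  qed
  \<comment> \<open>In the borderline case the potential is
    \<open>1 - \<mu>\<^sup>2 / r ^ 4\<close>, which stays below its limit: the maximum has moved to
    infinity.\<close>
  have le_1: "\<forall>\<^sub>F r in at_top. V r \<le> 1" if "L\<^sup>2 = \<mu>"
    using eventually_gt_at_top[of 0]
  proof eventually_elim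
    case (elim r)
    then show ?case using that assms(1) by (simp add: V eff_potential_4_eq)
  qed
  have not_max: "\<not> local_max_at V r" if "L\<^sup>2 < \<mu>" "r > 0" for r
    using deriv_zero_if_local_extremum[OF dV[OF that(2)]] radial_force_neg[OF assms(1) that] by auto
  show ?thesis
  proof (intro conjI impI)
    show "\<forall>E I t r \<phi>. geodesic_with 4 \<mu> E L I t r \<phi> \<and> future_inextendible 4 \<mu> I t r \<phi> \<and> E\<^sup>2 < 1 \<longrightarrow>
         (\<exists>T>0. I = {0..<T} \<and> (r \<longlongrightarrow> sqrt \<mu>) (at_left T) \<and>
            strict_mono_on I (\<lambda>\<tau>. - ptd I r \<tau>) \<and>
            (\<exists>s\<in>I. (\<forall>\<tau>\<in>{s<..<T}. ptd I r \<tau> < 0) \<and>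
               strict_mono_on {s..<T} (\<lambda>\<tau>. \<bar>ptd I r \<tau>\<bar>)))" if "L\<^sup>2 < \<mu>"
      using infall[OF assms(1) that] by blast
    show "\<not> (\<exists>E t r \<phi>. bounded_orbit 4 \<mu> E L t r \<phi> \<and> stable_orbit 4 \<mu> L r)"
      using bounded_orbit_not_stable[OF assms(1)] by blast
    show "(V \<longlongrightarrow> 1) at_top" unfolding V by (rule eff_potential_4_tendsto_1)
  qed (use deriv_0 max le_1 not_max not_local_min[OF assms(1), of _ L] V in auto)
qed

end
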